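(* Let $q\in\mathbb{N}$, $\alpha\in(1,\infty)$, let $G$ be a locally compact abelian group with dual group $\Gamma$, let $\lambda$ be a Haar measure on the Borel $\sigma$-algebra $\mathcal{B}(\Gamma)$, let $S\subseteq G$ be nonempty, and let $M$ be a regular measure on $\mathcal{B}(\Gamma)$ with values in the positive semidefinite Hermitian complex $q\times q$ matrices. Let $M=M_a+M_s$ be the Lebesgue decomposition of $M$ into its absolutely continuous part $M_a$ and singular part $M_s$ with respect to $\lambda$. If $$L^\alpha(M_s)\subseteq \overline{\mathcal{T}(G\setminus S)},$$ where the closure is taken in $L^\alpha(M)$, then for all $s\in S$ and $k\in\{1,\dots,q\}$, $$\inf\bigl\{\|\chi_{s}e_k-t\|_\alpha : t\in\mathcal{T}(G\setminus S)\bigr\}=\inf\left\{\left[\int_\Gamma\left\|\left(\frac{dM_a}{d\lambda}\right)^{1/\alpha}(\chi_{s}e_k-t)\right\|^\alpha d\lambda\right]^{1/\alpha} : t\in\mathcal{T}(G\setminus S)\right\},$$ where $\|\cdot\|_\alpha$ on the left-hand side is the norm of $L^\alpha(M)$.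
   Context: Regularity: a finite non-negative measure $\mu$ on $\mathcal{B}(\Gamma)$ is regular if for all $B\in\mathcal{B}(\Gamma)$ both $\mu(B)=\inf\{\mu(U): U \text{ open}, B\subseteq U\}$ and $\mu(B)=\sup\{\mu(K): K\text{ compact}, K\subseteq B\}$. A $\mathbb{C}$-valued measure is regular (absolutely continuous, singular) if its variation is regular (absolutely continuous, singular with respect to $\lambda$); a matrix-valued measure is regular if all its entries are. For regular $M$ as in the claim, the Radon-Nikodym derivative $dM_a/d\lambda$ exists. The space $L^\alpha(M)$: let $M$ be a measure on a measurable space $(\Omega,\mathcal{A})$ with values in the positive semidefinite $q\times q$ matrices, and let $\tau$ be a $\sigma$-finite measure with $M$ absolutely continuous with respect to $\tau$. Let $P(\omega)$ be the orthoprojection in $\mathbb{C}^q$ onto the range of $(dM/d\tau)(\omega)$. Measurable functions $f,g:\Omega\to\mathbb{C}^q$ are $M$-equivalent if $Pf=Pg$ $\tau$-a.e. $L^\alpha(M)$ is the Banach space of ($M$-equivalence classes of) measurable $f:\Omega\to\mathbb{C}^q$ with $\|f\|_\alpha:=\bigl[\int_\Omega\|(dM/d\tau)^{1/\alpha}f\|^\alpha d\tau\bigr]^{1/\alpha}<\infty$, where $\|\cdot\|$ is the Euclidean norm on $\mathbb{C}^q$; it does not depend on the choice of $\tau$. Identification: there is a Borel set $A$ with $M_a(A)=0$ and $M_s(\Gamma\setminus A)=0$; $L^\alpha(M_s)$ is identified with the subspace $\{1_Af: f\in L^\alpha(M)\}$ of $L^\alpha(M)$, where $1_A$ is the indicator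 function of $A$. Trigonometric polynomials: for $x\in G$, $\chi_x(\gamma):=\langle\gamma,x\rangle$ (the value of $\gamma\in\Gamma$ at $x$); $e_1,\dots,e_q$ is the standard orthonormal basis of $\mathbb{C}^q$. If $G\setminus S\neq\emptyset$, $\mathcal{T}(G\setminus S)$ is the linear space of all functions $\sum_{j=1}^n\chi_{x_j}u_j$ with $n\in\mathbb{N}$, $x_j\in G\setminus S$, $u_j\in\mathbb{C}^q$; if $G\setminus S=\emptyset$, it consists only of the zero function. *)

theory Defs
  imports "HOL-Analysis.Analysis"
begin

typedef (overloaded) ('a::topological_ab_group_add) dual_group =
  "{\<gamma> :: 'a \<Rightarrow> complex. continuous_on UNIV \<gamma> \<and> (\<forall>x. norm (\<gamma> x) = 1) \<and>
      (\<forall>x y. \<gamma> (x + y) = \<gamma> x * \<gamma> y)}"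
  morphisms pairing Abs_dual_group
  by (rule exI[of _ "\<lambda>_. 1"]) simp

setup_lifting type_definition_dual_group

text \<open>The group operation of the dual is pointwise multiplication, written additively.\<close>

instantiation dual_group :: (topological_ab_group_add) ab_group_add
begin

lift_definition zero_dual_group :: "'a dual_group" is "\<lambda>_. 1" by simp

lift_definition plus_dual_group :: "'a dual_group \<Rightarrow> 'a dual_group \<Rightarrow> 'a dual_group"
  is "\<lambda>\<gamma> \<delta> x. \<gamma> x * \<delta> x"
  by (auto intro!: continuous_intros simp: norm_mult)

lift_definition uminus_dual_group :: "'a dual_group \<Rightarrow> 'a dual_group"
  is "\<lambda>\<gamma> x. cnj (\<gamma> x)"
  by (auto intro!: continuous_intros)

definition minus_dual_group :: "'a dual_group \<Rightarrow> 'a dual_group \<Rightarrow> 'a dual_group"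
  where "minus_dual_group \<gamma> \<delta> = \<gamma> + - \<delta>"

instance
proof
  fix a b c :: "'a dual_group"
  show "a + b + c = a + (b + c)" by transfer (simp add: mult.assoc)
  show "a + b = b + a" by transfer (simp add: mult.commute)
  show "0 + a = a" by transfer simp
  show "- a + a = 0"
  proof (transfer, rule ext)
    fix \<gamma> :: "'a \<Rightarrow> complex" and x
    assume "continuous_on UNIV \<gamma> \<and> (\<forall>x. norm (\<gamma> x) = 1) \<and> (\<forall>x y. \<gamma> (x + y) = \<gamma> x * \<gamma> y)"
    then show "cnj (\<gamma> x) * \<gamma> x = 1"
      using complex_norm_square[of "\<gamma> x"] by (simp add: mult.commute)
  qed
  show "a - b = a + - b" by (rule minus_dual_group_def)
qed

end

lemma pairing_norm: "norm (pairing \<gamma> x) = 1"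
  using pairing[of \<gamma>] by simp

lemma pairing_continuous: "continuous_on A (pairing \<gamma>)"
  using pairing[of \<gamma>] continuous_on_subset by blast

lemma pairing_plus: "pairing (\<gamma> + \<delta>) x = pairing \<gamma> x * pairing \<delta> x"
  by (simp add: plus_dual_group.rep_eq)

lemma pairing_uminus: "pairing (- \<gamma>) x = cnj (pairing \<gamma> x)"
  by (simp add: uminus_dual_group.rep_eq)

text \<open>The topology of the dual is that of uniform convergence on compact sets.\<close>

definition dual_nbhd ::
    "'a::topological_ab_group_add dual_group \<Rightarrow> 'a set \<Rightarrow> real \<Rightarrow> 'a dual_group set"
  where "dual_nbhd \<gamma> K \<epsilon> = {\<delta>. \<forall>x\<in>K. norm (pairing \<delta> x - pairing \<gamma> x) < \<epsilon>}"

instantiation dual_group :: (topological_ab_group_add) topological_space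
begin

definition open_dual_group :: "'a dual_group set \<Rightarrow> bool"
  where "open_dual_group W \<longleftrightarrow> (\<forall>\<gamma>\<in>W. \<exists>K \<epsilon>. compact K \<and> \<epsilon> > 0 \<and> dual_nbhd \<gamma> K \<epsilon> \<subseteq> W)"

instance
proof
  show "open (UNIV :: 'a dual_group set)"
    unfolding open_dual_group_def
    by (intro ballI exI[of _ "{}"] exI[of _ "1::real"]) simp
next
  fix S T :: "'a dual_group set"
  assume S: "open S" and T: "open T"
  show "open (S \<inter> T)"
    unfolding open_dual_group_def
  proof
    fix \<gamma> assume "\<gamma> \<in> S \<inter> T"
    then have "\<gamma> \<in> S" "\<gamma> \<in> T" by auto
    from S \<open>\<gamma> \<in> S\<close> obtain K e where 1: "compact K" "e > 0" "dual_nbhd \<gamma> K e \<subseteq> S"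
      unfolding open_dual_group_def by (elim ballE exE conjE) auto
    from T \<open>\<gamma> \<in> T\<close> obtain L d where 2: "compact L" "d > 0" "dual_nbhd \<gamma> L d \<subseteq> T"
      unfolding open_dual_group_def by (elim ballE exE conjE) auto
    note * = 1 2
    then have "dual_nbhd \<gamma> (K \<union> L) (min e d) \<subseteq> S \<inter> T"
      by (intro Int_greatest subset_trans[OF _ 1(3)] subset_trans[OF _ 2(3)])
         (simp_all add: dual_nbhd_def Collect_mono_iff)
    with * show "\<exists>K \<epsilon>. compact K \<and> \<epsilon> > 0 \<and> dual_nbhd \<gamma> K \<epsilon> \<subseteq> S \<inter> T"
      by (intro exI[of _ "K \<union> L"] exI[of _ "min e d"]) (simp_all add: compact_Un)
  qed
next
  fix K :: "'a dual_group set set"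
  assume "\<forall>S\<in>K. open S"
  then show "open (\<Union> K)"
    unfolding open_dual_group_def
  proof (intro ballI)
    fix \<gamma> assume *: "\<forall>S\<in>K. \<forall>\<gamma>\<in>S. \<exists>L \<epsilon>. compact L \<and> \<epsilon> > 0 \<and> dual_nbhd \<gamma> L \<epsilon> \<subseteq> S" and "\<gamma> \<in> \<Union> K"
    then obtain S where S: "S \<in> K" "\<gamma> \<in> S" by blast
    obtain L e where L: "compact L" "e > 0" "dual_nbhd \<gamma> L e \<subseteq> S"
      using bspec[OF bspec[OF * S(1)] S(2)] by (elim exE conjE) auto
    then have "dual_nbhd \<gamma> L e \<subseteq> \<Union> K" using S(1) by (intro subset_trans[OF L(3)] Union_upper)
    with L show "\<exists>L \<epsilon>. compact L \<and> \<epsilon> > 0 \<and> dual_nbhd \<gamma> L \<epsilon> \<subseteq> \<Union> K" by (intro exI[of _ L] exI[of _ e]) simp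
  qed
qed

end

lemma open_dual_nbhd:
  fixes \<gamma> :: "'a::topological_ab_group_add dual_group"
  assumes "compact K"
  shows "open (dual_nbhd \<gamma> K \<epsilon>)"
proof (cases "K = {}")
  case True
  then have "dual_nbhd \<gamma> K \<epsilon> = UNIV" by (simp add: dual_nbhd_def)
  then show ?thesis by simp
next
  case False
  show ?thesis
    unfolding open_dual_group_def
  proof
    fix \<delta> assume d: "\<delta> \<in> dual_nbhd \<gamma> K \<epsilon>"
    have "continuous_on K (\<lambda>x. norm (pairing \<delta> x - pairing \<gamma> x))"
      by (intro continuous_intros pairing_continuous)
    then obtain x0 where x0: "x0 \<in> K"
      "\<And>y. y \<in> K \<Longrightarrow> norm (pairing \<delta> y - pairing \<gamma> y) \<le> norm (pairing \<delta> x0 - pairing \<gamma> x0)"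
      using continuous_attains_sup[OF assms False] by blast
    define r where "r = \<epsilon> - norm (pairing \<delta> x0 - pairing \<gamma> x0)"
    have r: "r > 0" using d x0(1) by (auto simp: dual_nbhd_def r_def)
    have "dual_nbhd \<delta> K r \<subseteq> dual_nbhd \<gamma> K \<epsilon>"
      unfolding dual_nbhd_def
    proof safe
      fix \<eta> y assume h: "\<forall>x\<in>K. norm (pairing \<eta> x - pairing \<delta> x) < r" and y: "y \<in> K"
      have "norm (pairing \<eta> y - pairing \<gamma> y)
          \<le> norm (pairing \<eta> y - pairing \<delta> y) + norm (pairing \<delta> y - pairing \<gamma> y)"
        using norm_triangle_ineq[of "pairing \<eta> y - pairing \<delta> y" "pairing \<delta> y - pairing \<gamma> y"] by simp
      then show "norm (pairing \<eta> y - pairing \<gamma> y) < \<epsilon>"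
        using bspec[OF h y] x0(2)[OF y] unfolding r_def by linarith
    qed
    with r assms show "\<exists>K' \<epsilon>'. compact K' \<and> \<epsilon>' > 0 \<and> dual_nbhd \<delta> K' \<epsilon>' \<subseteq> dual_nbhd \<gamma> K \<epsilon>"
      by (intro exI[of _ K] exI[of _ r]) simp
  qed
qed

lemma mem_dual_nbhd: "\<epsilon> > 0 \<Longrightarrow> \<gamma> \<in> dual_nbhd \<gamma> K \<epsilon>"
  by (simp add: dual_nbhd_def)

instance dual_group :: (topological_ab_group_add) t2_space
proof
  fix \<gamma> \<delta> :: "'a dual_group"
  assume "\<gamma> \<noteq> \<delta>"
  then have "pairing \<gamma> \<noteq> pairing \<delta>" by (simp add: pairing_inject)
  then obtain x where x: "pairing \<gamma> x \<noteq> pairing \<delta> x" by (auto simp: fun_eq_iff)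
  define r where "r = norm (pairing \<gamma> x - pairing \<delta> x) / 2"
  have r: "r > 0" using x by (simp add: r_def)
  have "dual_nbhd \<gamma> {x} r \<inter> dual_nbhd \<delta> {x} r = {}"
  proof -
    have False if "norm (pairing \<eta> x - pairing \<gamma> x) < r" "norm (pairing \<eta> x - pairing \<delta> x) < r" for \<eta>
      using that norm_triangle_ineq4[of "pairing \<eta> x - pairing \<delta> x" "pairing \<eta> x - pairing \<gamma> x"]
      by (simp add: r_def)
    then show ?thesis by (auto simp: dual_nbhd_def)
  qed
  then show "\<exists>U V. open U \<and> open V \<and> \<gamma> \<in> U \<and> \<delta> \<in> V \<and> U \<inter> V = {}"
    by (intro exI[of _ "dual_nbhd \<gamma> {x} r"] exI[of _ "dual_nbhd \<delta> {x} r"] conjI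
        open_dual_nbhd mem_dual_nbhd r) simp_all
qed

instance dual_group :: (topological_ab_group_add) topological_ab_group_add
proof
  fix a b :: "'a dual_group"
  show "((\<lambda>x. fst x + snd x) \<longlongrightarrow> a + b) (nhds a \<times>\<^sub>F nhds b)"
  proof (rule topological_tendstoI)
    fix W assume "open W" "a + b \<in> W"
    then obtain K e where K: "compact K" "e > 0" "dual_nbhd (a + b) K e \<subseteq> W"
      unfolding open_dual_group_def by blast
    have *: "x + y \<in> W" if "x \<in> dual_nbhd a K (e/2)" "y \<in> dual_nbhd b K (e/2)" for x y
    proof -
      have "norm (pairing (x + y) z - pairing (a + b) z) < e" if z: "z \<in> K" for z
      proof -
        have "pairing (x + y) z - pairing (a + b) z
            = (pairing x z - pairing a z) * pairing y z + pairing a z * (pairing y z - pairing b z)"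
          by (simp add: pairing_plus algebra_simps)
        also have "norm \<dots> \<le> norm (pairing x z - pairing a z) + norm (pairing y z - pairing b z)"
          by (rule order_trans[OF norm_triangle_ineq]) (simp add: norm_mult pairing_norm)
        also have "\<dots> < e/2 + e/2"
          using \<open>x \<in> _\<close> \<open>y \<in> _\<close> z by (intro add_strict_mono) (simp_all only: dual_nbhd_def mem_Collect_eq Ball_def)
        finally show ?thesis by simp
      qed
      then have "x + y \<in> dual_nbhd (a + b) K e" by (simp add: dual_nbhd_def)
      then show ?thesis using K(3) by (rule subsetD[rotated])
    qed
    have "\<forall>\<^sub>F x in nhds a. x \<in> dual_nbhd a K (e/2)" "\<forall>\<^sub>F y in nhds b. y \<in> dual_nbhd b K (e/2)"
      using K(1,2) by (simp_all add: eventually_nhds_in_open open_dual_nbhd mem_dual_nbhd)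
    then show "\<forall>\<^sub>F x in nhds a \<times>\<^sub>F nhds b. fst x + snd x \<in> W"
      unfolding eventually_prod_filter
      by (intro exI[of _ "\<lambda>x. x \<in> dual_nbhd a K (e/2)"] exI[of _ "\<lambda>y. y \<in> dual_nbhd b K (e/2)"])
         (simp add: *)
  qed
  show "(uminus \<longlongrightarrow> - a) (nhds a)"
  proof (rule topological_tendstoI)
    fix W assume "open W" "- a \<in> W"
    then obtain K e where K: "compact K" "e > 0" "dual_nbhd (- a) K e \<subseteq> W"
      unfolding open_dual_group_def by blast
    have "- x \<in> W" if "x \<in> dual_nbhd a K e" for x
    proof -
      have "norm (pairing (- x) z - pairing (- a) z) = norm (pairing x z - pairing a z)" for z
        by (simp add: pairing_uminus flip: complex_cnj_diff)
      then have "- x \<in> dual_nbhd (- a) K e" using that by (simp add: dual_nbhd_def)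
      then show ?thesis using K(3) by (rule subsetD[rotated])
    qed
    moreover have "\<forall>\<^sub>F x in nhds a. x \<in> dual_nbhd a K e"
      using K(1,2) by (simp_all add: eventually_nhds_in_open open_dual_nbhd mem_dual_nbhd)
    ultimately show "\<forall>\<^sub>F x in nhds a. - x \<in> W"
      by (rule eventually_mono[rotated])
  qed
qed

text \<open>Haar measures are nonzero translation-invariant Radon measures: locally finite, outer regular
  on all Borel sets and inner regular on open sets. They need not be \<open>\<sigma>\<close>-finite.\<close>

definition haar_measure :: "'g::{topological_ab_group_add,t2_space} measure \<Rightarrow> bool"
  where "haar_measure \<nu> \<longleftrightarrow>
     sets \<nu> = sets borel \<and>
     emeasure \<nu> UNIV \<noteq> 0 \<and>
     (\<forall>\<gamma>. \<forall>B\<in>sets borel. emeasure \<nu> ((+) \<gamma> ` B) = emeasure \<nu> B) \<and>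
     (\<forall>K. compact K \<longrightarrow> emeasure \<nu> K < \<infinity>) \<and>
     (\<forall>B\<in>sets borel. emeasure \<nu> B = (INF U\<in>{U. open U \<and> B \<subseteq> U}. emeasure \<nu> U)) \<and>
     (\<forall>U. open U \<longrightarrow> emeasure \<nu> U = (SUP K\<in>{K. compact K \<and> K \<subseteq> U}. emeasure \<nu> K))"

text \<open>Vector-valued measures are set functions constrained only on the \<open>\<sigma>\<close>-algebra
  of \<open>N\<close>; the measure carried by \<open>N\<close> plays no role in the next two definitions.\<close>

definition vector_measure :: "'w measure \<Rightarrow> ('w set \<Rightarrow> 'b::real_normed_vector) \<Rightarrow> bool"
  where "vector_measure N \<mu> \<longleftrightarrow> \<mu> {} = 0 \<and>
     (\<forall>A::nat \<Rightarrow> 'w set. range A \<subseteq> sets N \<longrightarrow> disjoint_family A \<longrightarrow>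
        (\<lambda>i. \<mu> (A i)) sums \<mu> (\<Union>i. A i))"

definition variation :: "'w measure \<Rightarrow> ('w set \<Rightarrow> complex) \<Rightarrow> 'w set \<Rightarrow> ennreal"
  where "variation N \<mu> B =
     (SUP P\<in>{P. finite P \<and> P \<subseteq> sets N \<and> partition_on B P}. \<Sum>E\<in>P. ennreal (norm (\<mu> E)))"

definition regular_set_function :: "('g::t2_space set \<Rightarrow> ennreal) \<Rightarrow> bool"
  where "regular_set_function \<mu> \<longleftrightarrow> (\<forall>B\<in>sets borel.
     \<mu> B = (INF U\<in>{U. open U \<and> B \<subseteq> U}. \<mu> U) \<and>
     \<mu> B = (SUP K\<in>{K. compact K \<and> K \<subseteq> B}. \<mu> K))"

definition regular_matrix_measure :: "('g::t2_space set \<Rightarrow> complex^'q^'q) \<Rightarrow> bool"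
  where "regular_matrix_measure M \<longleftrightarrow>
     (\<forall>i j. regular_set_function (variation borel (\<lambda>B. M B $ i $ j)))"

definition abs_continuous :: "'w measure \<Rightarrow> ('w set \<Rightarrow> complex^'q^'q) \<Rightarrow> bool"
  where "abs_continuous \<tau> M \<longleftrightarrow>
     (\<forall>i j. \<forall>B\<in>sets \<tau>. emeasure \<tau> B = 0 \<longrightarrow> variation \<tau> (\<lambda>E. M E $ i $ j) B = 0)"

definition singular :: "'w measure \<Rightarrow> ('w set \<Rightarrow> complex^'q^'q) \<Rightarrow> bool"
  where "singular \<tau> M \<longleftrightarrow>
     (\<forall>i j. \<exists>N\<in>sets \<tau>. emeasure \<tau> N = 0 \<and> variation \<tau> (\<lambda>E. M E $ i $ j) (space \<tau> - N) = 0)"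

definition lebesgue_decomposition ::
    "'w measure \<Rightarrow> ('w set \<Rightarrow> complex^'q^'q) \<Rightarrow> ('w set \<Rightarrow> complex^'q^'q) \<Rightarrow>
      ('w set \<Rightarrow> complex^'q^'q) \<Rightarrow> bool"
  where "lebesgue_decomposition \<tau> M Ma Ms \<longleftrightarrow>
     vector_measure \<tau> Ma \<and> vector_measure \<tau> Ms \<and>
     (\<forall>B\<in>sets \<tau>. M B = Ma B + Ms B) \<and> abs_continuous \<tau> Ma \<and> singular \<tau> Ms"

definition adjoint_matrix :: "complex^'m^'n \<Rightarrow> complex^'n^'m"
  where "adjoint_matrix A = (\<chi> i j. cnj (A $ j $ i))"

definition pos_semidef :: "complex^'q^'q \<Rightarrow> bool"
  where "pos_semidef A \<longleftrightarrow> adjoint_matrix A = A \<and>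
     (\<forall>v. 0 \<le> Re (\<Sum>i\<in>UNIV. cnj (v $ i) * (A *v v) $ i))"

definition psd_measure :: "'w measure \<Rightarrow> ('w set \<Rightarrow> complex^'q^'q) \<Rightarrow> bool"
  where "psd_measure N M \<longleftrightarrow> vector_measure N M \<and> (\<forall>B\<in>sets N. pos_semidef (M B))"

definition has_RN_derivative ::
    "'w measure \<Rightarrow> ('w set \<Rightarrow> complex^'q^'q) \<Rightarrow> ('w \<Rightarrow> complex^'q^'q) \<Rightarrow> bool"
  where "has_RN_derivative \<tau> M D \<longleftrightarrow>
     integrable \<tau> D \<and> (\<forall>B\<in>sets \<tau>. M B = set_lebesgue_integral \<tau> B D)"

text \<open>Determined only up to \<open>\<tau>\<close>-null sets, and meaningful only if a derivative exists.\<close>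

definition RN_derivative ::
    "'w measure \<Rightarrow> ('w set \<Rightarrow> complex^'q^'q) \<Rightarrow> 'w \<Rightarrow> complex^'q^'q"
  where "RN_derivative \<tau> M = (SOME D. has_RN_derivative \<tau> M D)"

definition diagonal_matrix :: "('q \<Rightarrow> real) \<Rightarrow> complex^'q^'q"
  where "diagonal_matrix d = (\<chi> i j. if i = j then of_real (d i) else 0)"

definition unitary_matrix :: "complex^'q^'q \<Rightarrow> bool"
  where "unitary_matrix U \<longleftrightarrow> adjoint_matrix U ** U = mat 1 \<and> U ** adjoint_matrix U = mat 1"

text \<open>Only used for \<open>r > 0\<close>, where \<open>0 powr r = 0\<close> is the right convention. If \<open>A\<close> is not
  positive semidefinite, no \<open>B\<close> qualifies and the value is a constant independent of \<open>A\<close>.\<close>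

definition psd_power :: "complex^'q^'q \<Rightarrow> real \<Rightarrow> complex^'q^'q"
  where "psd_power A r = (THE B. \<exists>U d. unitary_matrix U \<and> (\<forall>i. 0 \<le> d i) \<and>
     A = U ** diagonal_matrix d ** adjoint_matrix U \<and>
     B = U ** diagonal_matrix (\<lambda>i. d i powr r) ** adjoint_matrix U)"

definition range_projection :: "complex^'q^'q \<Rightarrow> complex^'q^'q"
  where "range_projection A = (THE P. P ** P = P \<and> adjoint_matrix P = P \<and>
     range ((*v) P) = range ((*v) A))"

text \<open>Below, \<open>\<tau>\<close> is an auxiliary \<open>\<sigma>\<close>-finite measure dominating \<open>M\<close>; its choice does not
  affect the resulting spaces and norms.\<close>

definition L_norm ::
    "'w measure \<Rightarrow> real \<Rightarrow> ('w set \<Rightarrow> complex^'q^'q) \<Rightarrow> ('w \<Rightarrow> complex^'q) \<Rightarrow> real"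
  where "L_norm \<tau> \<alpha> M f =
     (\<integral>\<omega>. norm (psd_power (RN_derivative \<tau> M \<omega>) (1 / \<alpha>) *v f \<omega>) powr \<alpha> \<partial>\<tau>) powr (1 / \<alpha>)"

definition L_functions ::
    "'w measure \<Rightarrow> real \<Rightarrow> ('w set \<Rightarrow> complex^'q^'q) \<Rightarrow> ('w \<Rightarrow> complex^'q) set"
  where "L_functions \<tau> \<alpha> M = {f \<in> borel_measurable \<tau>.
     integrable \<tau> (\<lambda>\<omega>. norm (psd_power (RN_derivative \<tau> M \<omega>) (1 / \<alpha>) *v f \<omega>) powr \<alpha>)}"

definition M_equivalent ::
    "'w measure \<Rightarrow> ('w set \<Rightarrow> complex^'q^'q) \<Rightarrow> ('w \<Rightarrow> complex^'q) \<Rightarrow> ('w \<Rightarrow> complex^'q) \<Rightarrow> bool"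
  where "M_equivalent \<tau> M f g \<longleftrightarrow>
     (AE \<omega> in \<tau>. range_projection (RN_derivative \<tau> M \<omega>) *v f \<omega> =
                  range_projection (RN_derivative \<tau> M \<omega>) *v g \<omega>)"

definition L_class ::
    "'w measure \<Rightarrow> ('w set \<Rightarrow> complex^'q^'q) \<Rightarrow> ('w \<Rightarrow> complex^'q) \<Rightarrow> ('w \<Rightarrow> complex^'q) set"
  where "L_class \<tau> M f = {g \<in> borel_measurable \<tau>. M_equivalent \<tau> M f g}"

definition L_space ::
    "'w measure \<Rightarrow> real \<Rightarrow> ('w set \<Rightarrow> complex^'q^'q) \<Rightarrow> ('w \<Rightarrow> complex^'q) set set"
  where "L_space \<tau> \<alpha> M = L_class \<tau> M ` L_functions \<tau> \<alpha> M"

definition L_dist ::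
    "'w measure \<Rightarrow> real \<Rightarrow> ('w set \<Rightarrow> complex^'q^'q) \<Rightarrow>
      ('w \<Rightarrow> complex^'q) set \<Rightarrow> ('w \<Rightarrow> complex^'q) set \<Rightarrow> real"
  where "L_dist \<tau> \<alpha> M F G = L_norm \<tau> \<alpha> M (\<lambda>\<omega>. (SOME f. f \<in> F) \<omega> - (SOME g. g \<in> G) \<omega>)"

definition L_closure ::
    "'w measure \<Rightarrow> real \<Rightarrow> ('w set \<Rightarrow> complex^'q^'q) \<Rightarrow>
      ('w \<Rightarrow> complex^'q) set set \<Rightarrow> ('w \<Rightarrow> complex^'q) set set"
  where "L_closure \<tau> \<alpha> M X =
     Metric_space.mtopology (L_space \<tau> \<alpha> M) (L_dist \<tau> \<alpha> M) closure_of X"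

text \<open>The copy of the space of the singular part inside the space of \<open>M\<close>; \<open>A\<close> is a set that
  carries the singular part and is null for the absolutely continuous part.\<close>

definition L_singular_space ::
    "'w measure \<Rightarrow> real \<Rightarrow> ('w set \<Rightarrow> complex^'q^'q) \<Rightarrow> 'w set \<Rightarrow> ('w \<Rightarrow> complex^'q) set set"
  where "L_singular_space \<tau> \<alpha> M A =
     L_class \<tau> M ` {\<lambda>\<omega>. indicator A \<omega> *\<^sub>R f \<omega> | f. f \<in> L_functions \<tau> \<alpha> M}"

definition chi :: "'a::topological_ab_group_add \<Rightarrow> 'a dual_group \<Rightarrow> complex"
  where "chi x \<gamma> = pairing \<gamma> x"

text \<open>For \<open>X = {}\<close> only \<open>n = 0\<close> is possible, so that the zero function is the only element.\<close>

definition trig_polys ::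
    "'a::topological_ab_group_add set \<Rightarrow> ('a dual_group \<Rightarrow> complex^'q) set"
  where "trig_polys X = {\<lambda>\<gamma>. \<Sum>j<n. chi (x j) \<gamma> *s u j | (n::nat) x u. \<forall>j<n. x j \<in> X}"

end

theory Submission
  imports Defs
begin

text \<open>
  The idea is that the singular part of \<open>M\<close> can be removed from the approximation problem at no cost.
  For a trigonometric polynomial \<open>t\<close> put \<open>f = \<chi>\<^sub>s e\<^sub>k - t\<close> and split \<open>f\<close> into \<open>1\<^sub>A f\<close> and the remainder
  \<open>h\<close>, which vanishes on \<open>A\<close>. The norm of \<open>h\<close> in \<open>L\<^sup>\<alpha>(M)\<close> is the quantity that is minimized on the right-hand
  side of the claim, so the right-hand side is at most the left-hand side. Conversely \<open>1\<^sub>A f\<close> lies in the space of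
  the singular part, so by hypothesis some \<open>p\<close> in the same space of trigonometric polynomials is
  arbitrarily close to it. Then \<open>t + p\<close> is an admissible competitor, and the norm of \<open>f - p\<close> exceeds that
  of \<open>h\<close> by at most an arbitrarily small amount.

  Three facts make this rigorous. First, the norm of \<open>h\<close> equals the integral over the Haar measure
  in the claim (\<open>weighted_integral_abs_part\<close>): \<open>Ma\<close> is \<open>M\<close> restricted to the complement of \<open>A\<close>
  (\<open>lebesgue_decomposition_abs_part\<close>), and weighted integrals do not depend on the dominating measure, because both
  can be transported to the trace measure of \<open>Ma\<close> (\<open>weighted_integral_eq_trace_measure\<close>). Second, the derivatives exist.
  For \<open>\<tau>\<close> this follows from the scalar Radon-Nikodym theorem by polarization (\<open>psd_measure_RN_exists\<close>); a Haar
  measure need not be \<open>\<sigma>\<close>-finite, but a regular measure lives on a \<open>\<sigma>\<close>-compact set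
  (\<open>regular_psd_measure_sigma_compact\<close>). Third, \<open>L\<^sup>\<alpha>(M)\<close> is a metric space (\<open>Metric_space_L\<close>), so that closure
  means approximation. This rests on Minkowski's inequality and on the spectral theorem, which
  gives sense to the matrix powers and shows that the power \<open>(dM/d\<tau>)\<^sup>1\<^sup>/\<^sup>\<alpha>\<close> has the same kernel as the projection
  onto the range of \<open>dM/d\<tau>\<close>.
\<close>

section \<open>The Hermitian inner product and unitary matrices\<close>

definition hdot :: "complex^'n \<Rightarrow> complex^'n \<Rightarrow> complex"
  where "hdot x y = (\<Sum>i\<in>UNIV. cnj (x $ i) * y $ i)"

lemma pos_semidef_iff:
  "pos_semidef A \<longleftrightarrow> adjoint_matrix A = A \<and> (\<forall>v. 0 \<le> Re (hdot v (A *v v)))"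
  by (simp add: pos_semidef_def hdot_def)

text \<open>The Hermitian product refines the real inner product of the underlying real space, so that
  compactness, dimension and orthogonality arguments can be carried out over the reals.\<close>

lemma Re_hdot: "Re (hdot x y) = inner x y"
  by (simp add: hdot_def inner_vec_def inner_complex_def)

lemma hdot_add_right: "hdot x (y + z) = hdot x y + hdot x z"
  by (simp add: hdot_def algebra_simps sum.distrib)

lemma hdot_smult_right: "hdot x (c *s y) = c * hdot x y"
  by (simp add: hdot_def sum_distrib_left mult_ac)

lemma hdot_smult_left: "hdot (c *s x) y = cnj c * hdot x y"
  by (simp add: hdot_def sum_distrib_left mult_ac)

lemma hdot_scaleR_right: "hdot x (r *\<^sub>R y) = of_real r * hdot x y"
  by (simp add: hdot_def sum_distrib_left scaleR_conv_of_real[where 'a=complex] mult_ac)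

lemma hdot_scaleR_left: "hdot (r *\<^sub>R x) y = of_real r * hdot x y"
  by (simp add: hdot_def sum_distrib_left scaleR_conv_of_real[where 'a=complex] mult_ac)

lemma hdot_commute: "hdot y x = cnj (hdot x y)"
  by (simp add: hdot_def mult_ac)

lemma hdot_self: "hdot x x = of_real ((norm x)\<^sup>2)"
proof -
  have "Im (hdot x x) = 0" using hdot_commute[of x x] by (metis cnj.simps(2) equal_neg_zero)
  moreover have "Re (hdot x x) = (norm x)\<^sup>2" by (simp add: Re_hdot power2_norm_eq_inner)
  ultimately show ?thesis by (simp add: complex_eq_iff)
qed

lemma hdot_adjoint: "hdot (adjoint_matrix A *v x) y = hdot x (A *v y)"
proof -
  have "hdot (adjoint_matrix A *v x) y = (\<Sum>i\<in>UNIV. \<Sum>j\<in>UNIV. cnj (x $ j) * A $ j $ i * y $ i)"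
    by (simp add: hdot_def adjoint_matrix_def matrix_vector_mult_def sum_distrib_left sum_distrib_right mult_ac)
  also have "\<dots> = (\<Sum>j\<in>UNIV. \<Sum>i\<in>UNIV. cnj (x $ j) * A $ j $ i * y $ i)"
    by (rule sum.swap)
  also have "\<dots> = hdot x (A *v y)"
    by (simp add: hdot_def matrix_vector_mult_def sum_distrib_left mult_ac)
  finally show ?thesis .
qed

lemma adjoint_adjoint [simp]: "adjoint_matrix (adjoint_matrix A) = A"
  by (simp add: adjoint_matrix_def vec_eq_iff)

lemma adjoint_matrix_mult: "adjoint_matrix (A ** B) = adjoint_matrix B ** adjoint_matrix A"
  by (simp add: adjoint_matrix_def vec_eq_iff matrix_matrix_mult_def mult_ac)

lemma adjoint_diagonal [simp]: "adjoint_matrix (diagonal_matrix d) = diagonal_matrix d"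
  by (auto simp: adjoint_matrix_def vec_eq_iff diagonal_matrix_def)

lemma diagonal_matrix_nth [simp]: "diagonal_matrix d $ i $ j = (if i = j then of_real (d i) else 0)"
  by (simp add: diagonal_matrix_def)

lemma mult_diagonal_nth: "(A ** diagonal_matrix d) $ i $ j = A $ i $ j * of_real (d j)"
  by (simp add: matrix_matrix_mult_def if_distrib sum.delta' cong: if_cong)

lemma diagonal_mult_nth: "(diagonal_matrix d ** A) $ i $ j = of_real (d i) * A $ i $ j"
  by (simp add: matrix_matrix_mult_def if_distrib if_distribR cong: if_cong)

lemma diagonal_mult_vec_nth: "(diagonal_matrix d *v x) $ i = of_real (d i) * x $ i"
  by (simp add: matrix_vector_mult_def if_distrib if_distribR cong: if_cong)

lemma diagonal_mult_diagonal: "diagonal_matrix d ** diagonal_matrix e = diagonal_matrix (\<lambda>i. d i * e i)"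
  by (simp add: vec_eq_iff diagonal_mult_nth)

lemma diagonal_one: "diagonal_matrix (\<lambda>_. 1) = mat 1"
  by (simp add: vec_eq_iff mat_def)

lemma unitary_adjoint_mult: "unitary_matrix U \<Longrightarrow> adjoint_matrix U ** U = mat 1"
  and unitary_mult_adjoint: "unitary_matrix U \<Longrightarrow> U ** adjoint_matrix U = mat 1"
  by (simp_all add: unitary_matrix_def)

lemma unitary_adjoint: "unitary_matrix U \<Longrightarrow> unitary_matrix (adjoint_matrix U)"
  by (simp add: unitary_matrix_def)

lemma unitary_norm:
  assumes "unitary_matrix U"
  shows "norm (U *v x) = norm x"
proof -
  have "hdot (U *v x) (U *v x) = hdot (adjoint_matrix (adjoint_matrix U) *v x) (U *v x)" by simp
  also have "\<dots> = hdot x x"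
    unfolding hdot_adjoint
    by (simp add: matrix_vector_mul_assoc unitary_adjoint_mult[OF assms])
  finally have "(norm (U *v x))\<^sup>2 = (norm x)\<^sup>2" unfolding hdot_self of_real_eq_iff .
  then show ?thesis by simp
qed

lemma scaleR_matrix_vector: "(r *\<^sub>R A) *v x = r *\<^sub>R (A *v x)" for A :: "complex^'n^'m"
  by (simp add: vec_eq_iff matrix_vector_mult_def scaleR_sum_right)

lemma matrix_vector_scaleR: "A *v (r *\<^sub>R x) = r *\<^sub>R (A *v x)" for A :: "complex^'n^'m"
  by (simp add: vec_eq_iff matrix_vector_mult_def scaleR_sum_right)

lemma hermitian_inner:
  assumes "adjoint_matrix A = A"
  shows "inner (A *v x) y = inner x (A *v y)"
  using hdot_adjoint[of A x y] by (simp add: assms flip: Re_hdot)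

lemma continuous_on_matrix_vector [continuous_intros]:
  fixes f :: "'t::topological_space \<Rightarrow> complex^'n^'m"
  assumes "continuous_on S f" "continuous_on S g"
  shows "continuous_on S (\<lambda>x. f x *v g x)"
  unfolding matrix_vector_mult_def by (intro continuous_intros assms)

section \<open>The spectral theorem and powers of positive semidefinite matrices\<close>

text \<open>The Rayleigh quotient attains its maximum on the unit sphere of \<open>V\<close>, and a maximizer is an
  eigenvector. The argument uses real scalars only, so \<open>V\<close> may be any real subspace.\<close>

lemma hermitian_eigenvector_in_invariant_subspace:
  fixes A :: "complex^'q^'q"
  assumes herm: "adjoint_matrix A = A" and V: "subspace V" "x0 \<in> V" "x0 \<noteq> 0"
    and inv: "\<And>x. x \<in> V \<Longrightarrow> A *v x \<in> V"
  shows "\<exists>x\<in>V. norm x = 1 \<and> (\<exists>l::real. A *v x = l *\<^sub>R x)"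
proof -
  have K: "compact (sphere 0 1 \<inter> V)" by (intro compact_Int_closed closed_subspace V compact_sphere)
  have "(1 / norm x0) *\<^sub>R x0 \<in> sphere 0 1 \<inter> V"
    using V by (auto simp: subspace_scale)
  then have ne: "sphere 0 1 \<inter> V \<noteq> {}" by blast
  have "continuous_on (sphere 0 1 \<inter> V) (\<lambda>x. inner x (A *v x))"
    by (intro continuous_intros)
  then obtain x where x: "x \<in> sphere 0 1 \<inter> V"
    and max: "\<And>y. y \<in> sphere 0 1 \<inter> V \<Longrightarrow> inner y (A *v y) \<le> inner x (A *v x)"
    using continuous_attains_sup[OF K ne] by blast
  define l where "l = inner x (A *v x)"
  define z where "z = l *\<^sub>R x - A *v x"
  have z: "z \<in> V" using x V inv by (auto simp: z_def intro!: subspace_diff subspace_scale)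
  have le: "inner y (A *v y) \<le> l * (norm y)\<^sup>2" if "y \<in> V" for y
  proof (cases "y = 0")
    case False
    define w where "w = (1 / norm y) *\<^sub>R y"
    have w: "w \<in> sphere 0 1 \<inter> V" using that False V by (auto simp: w_def subspace_scale)
    have yw: "y = norm y *\<^sub>R w" using False by (simp add: w_def)
    have "inner y (A *v y) = (norm y)\<^sup>2 * inner w (A *v w)"
      by (subst (1 2) yw) (simp add: matrix_vector_scaleR power2_eq_square)
    also have "\<dots> \<le> (norm y)\<^sup>2 * l" using max[OF w] by (simp add: l_def mult_left_mono)
    finally show ?thesis by (simp add: mult.commute)
  qed simp
  \<comment> \<open>The nonnegative form \<open>l \<parallel>y\<parallel>\<^sup>2 - \<langle>y, A y\<rangle>\<close> vanishes at \<open>x\<close>; its values along \<open>x - e z\<close>,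
    \<open>e \<rightarrow> 0\<close>, force its gradient \<open>z\<close> to vanish as well.\<close>
  have "z = 0"
  proof (rule ccontr)
    assume "z \<noteq> 0"
    define g where "g = l * (norm z)\<^sup>2 - inner z (A *v z)"
    have nx: "inner x x = 1" using x by (simp add: norm_eq_1)
    have key: "0 \<le> - 2 * e * (norm z)\<^sup>2 + e\<^sup>2 * g" for e
    proof -
      have V': "x - e *\<^sub>R z \<in> V" using x z V by (auto intro!: subspace_diff subspace_scale)
      have 1: "inner z (A *v x) = inner x (A *v z)"
        using hermitian_inner[OF herm, of x z] by (simp add: inner_commute)
      have 2: "inner z z = l * inner x z - inner x (A *v z)"
        using hermitian_inner[OF herm, of x z]
        by (subst (1) z_def) (simp add: inner_diff_left)
      have n2: "(norm (x - e *\<^sub>R z))\<^sup>2 = 1 - 2 * e * inner x z + e\<^sup>2 * inner z z"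
        unfolding power2_norm_eq_inner
        by (simp add: inner_diff_left inner_diff_right nx inner_commute power2_eq_square)
      have n3: "inner (x - e *\<^sub>R z) (A *v (x - e *\<^sub>R z))
          = l - 2 * e * inner x (A *v z) + e\<^sup>2 * inner z (A *v z)"
        by (simp add: matrix_vector_mult_diff_distrib matrix_vector_scaleR inner_diff_left
            inner_diff_right 1 l_def power2_eq_square algebra_simps)
      have "0 \<le> - 2 * e * (l * inner x z - inner x (A *v z)) + e\<^sup>2 * (l * inner z z - inner z (A *v z))"
        using le[OF V'] unfolding n2 n3 by (simp add: algebra_simps)
      then show ?thesis unfolding g_def power2_norm_eq_inner using 2 by simp
    qed
    have "g > 0 \<or> g \<le> 0" by linarith
    then show False
    proof
      assume "g > 0"
      \<comment> \<open>The minimizer \<open>e = \<parallel>z\<parallel>\<^sup>2 / g\<close> of the quadratic polynomial gives a contradiction.\<close>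
      have "0 \<le> - 2 * ((norm z)\<^sup>2 / g) * (norm z)\<^sup>2 + ((norm z)\<^sup>2 / g)\<^sup>2 * g" by (rule key)
      also have "\<dots> = - ((norm z)\<^sup>2 * (norm z)\<^sup>2 / g)" using \<open>g > 0\<close> by (simp add: field_simps power2_eq_square)
      also have "\<dots> < 0" using \<open>g > 0\<close> \<open>z \<noteq> 0\<close> by simp
      finally show False by simp
    next
      assume "g \<le> 0"
      then show False using key[of 1] \<open>z \<noteq> 0\<close> by (simp add: not_le) (smt (verit) zero_less_norm_iff zero_less_power)
    qed
  qed
  then have "A *v x = l *\<^sub>R x" by (simp add: z_def)
  then show ?thesis using x by auto
qed

text \<open>An orthonormal system of eigenvectors indexed by a proper subset of the coordinates can be enlarged
  by one vector: its orthogonal complement is invariant and nonzero and hence contains an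
  eigenvector. Indexing by coordinates rather than by numbers yields a square matrix in the end.\<close>

lemma hermitian_partial_eigenbasis:
  fixes A :: "complex^'q^'q" and I :: "'q set"
  assumes herm: "adjoint_matrix A = A"
  shows "\<exists>u l. \<forall>i\<in>I. A *v u i = (l i :: real) *\<^sub>R u i \<and> (\<forall>j\<in>I. hdot (u i) (u j) = (if i = j then 1 else 0))"
proof (induction I rule: finite_induct[OF finite])
  case 1
  then show ?case by simp
next
  case (2 k I)
  then obtain u l where eig: "\<And>i. i \<in> I \<Longrightarrow> A *v u i = (l i :: real) *\<^sub>R u i"
    and on: "\<And>i j. i \<in> I \<Longrightarrow> j \<in> I \<Longrightarrow> hdot (u i) (u j) = (if i = j then 1 else 0)" by blast
  define V where "V = {x. \<forall>i\<in>I. hdot (u i) x = 0}"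
  \<comment> \<open>Real orthogonality to both \<open>u i\<close> and \<open>\<i> u i\<close> is complex orthogonality to \<open>u i\<close>.\<close>
  define B where "B = u ` I \<union> (\<lambda>i. \<i> *s u i) ` I"
  have "subspace V"
    by (auto simp: V_def subspace_def hdot_add_right hdot_scaleR_right) (simp add: hdot_def)
  moreover have "A *v x \<in> V" if "x \<in> V" for x
    using that by (simp add: V_def hdot_adjoint[symmetric] herm eig hdot_scaleR_left)
  moreover obtain x0 where "x0 \<in> V" "x0 \<noteq> 0"
  proof -
    have "card B \<le> card I + card I"
      unfolding B_def by (rule order_trans[OF card_Un_le]) (intro add_mono card_image_le finite)
    moreover have "card I < CARD('q)" using 2 by (metis UNIV_I finite psubsetI psubset_card_mono subset_UNIV)
    moreover have "dim (span B) \<le> card B" by (simp add: dim_le_card' B_def)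
    ultimately have "dim (span B) < DIM(complex^'q)" by simp
    then obtain x where x: "x \<noteq> 0" "\<And>y. y \<in> span B \<Longrightarrow> orthogonal x y"
      using orthogonal_to_subspace_exists[of "span B"] by (metis dim_span span_span)
    have "hdot (u i) x = 0" if i: "i \<in> I" for i
    proof (rule complex_eqI)
      have "orthogonal x (u i)" "orthogonal x (\<i> *s u i)"
        using i by (auto intro!: x(2) span_base simp: B_def)
      then have "Re (hdot (u i) x) = 0" "Re (hdot (\<i> *s u i) x) = 0"
        by (simp_all add: Re_hdot orthogonal_def inner_commute)
      then show "Re (hdot (u i) x) = Re 0" "Im (hdot (u i) x) = Im 0"
        by (simp_all add: hdot_smult_left)
    qed
    then show ?thesis using that x(1) by (auto simp: V_def)
  qed
  ultimately obtain x m where x: "x \<in> V" "norm x = 1" "A *v x = (m::real) *\<^sub>R x"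
    using hermitian_eigenvector_in_invariant_subspace[OF herm] by blast
  have 1: "hdot (u i) x = 0" "hdot x (u i) = 0" if "i \<in> I" for i
    using x(1) that hdot_commute[of x "u i"] by (auto simp: V_def)
  have 2: "hdot x x = 1" by (simp add: hdot_self x(2))
  show ?case
    using \<open>k \<notin> I\<close> by (intro exI[of _ "u(k := x)"] exI[of _ "l(k := m)"]) (auto simp: x eig on 1 2)
qed

theorem psd_spectral:
  fixes A :: "complex^'q^'q"
  assumes psd: "pos_semidef A"
  obtains U d where "unitary_matrix U" "\<And>i. 0 \<le> d i" "A = U ** diagonal_matrix d ** adjoint_matrix U"
proof -
  have herm: "adjoint_matrix A = A" using psd by (simp add: pos_semidef_def)
  obtain u l where eig: "\<And>i. A *v u i = (l i :: real) *\<^sub>R u i"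
    and on: "\<And>i j::'q. hdot (u i) (u j) = (if i = j then 1 else 0)"
    using hermitian_partial_eigenbasis[OF herm, of UNIV] by auto
  define U where "U = (\<chi> i j. u j $ i)"
  have "adjoint_matrix U ** U = mat 1"
    using on by (simp add: vec_eq_iff adjoint_matrix_def U_def matrix_matrix_mult_def mat_def hdot_def)
  then have U: "unitary_matrix U" by (simp add: unitary_matrix_def matrix_left_right_inverse)
  have "A ** U = U ** diagonal_matrix l"
  proof -
    have "(A ** U) $ i $ j = (A *v u j) $ i" for i j
      by (simp add: U_def matrix_matrix_mult_def matrix_vector_mult_def)
    then show ?thesis
      by (simp add: vec_eq_iff mult_diagonal_nth eig U_def scaleR_conv_of_real[where 'a=complex] mult.commute)
  qed
  then have "A ** (U ** adjoint_matrix U) = U ** diagonal_matrix l ** adjoint_matrix U"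
    by (simp add: matrix_mul_assoc)
  then have "A = U ** diagonal_matrix l ** adjoint_matrix U"
    by (simp add: unitary_mult_adjoint[OF U])
  moreover have "0 \<le> l i" for i
  proof -
    have "0 \<le> Re (hdot (u i) (A *v u i))" using psd by (simp add: pos_semidef_iff)
    then show ?thesis by (simp add: eig hdot_scaleR_right on)
  qed
  ultimately show ?thesis using that U by blast
qed

text \<open>If \<open>W = V\<^sup>* U\<close> intertwines two diagonal matrices, then \<open>W i j \<noteq> 0\<close> forces the corresponding
  eigenvalues to agree, so \<open>W\<close> also intertwines the images under \<open>f\<close>. This makes every function of
  a positive semidefinite matrix independent of the diagonalization.\<close>

lemma spectral_function_unique:
  assumes U: "unitary_matrix U" and V: "unitary_matrix V"
    and eq: "U ** diagonal_matrix d ** adjoint_matrix U = V ** diagonal_matrix e ** adjoint_matrix V"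
  shows "U ** diagonal_matrix (\<lambda>i. f (d i)) ** adjoint_matrix U
       = V ** diagonal_matrix (\<lambda>i. f (e i)) ** adjoint_matrix V"
proof -
  define W where "W = adjoint_matrix V ** U"
  have UW: "U = V ** W" by (simp add: W_def matrix_mul_assoc unitary_mult_adjoint[OF V])
  have VW: "adjoint_matrix V = W ** adjoint_matrix U"
    by (simp add: W_def unitary_mult_adjoint[OF U] flip: matrix_mul_assoc)
  have "adjoint_matrix V ** (U ** diagonal_matrix d ** adjoint_matrix U) ** U
      = adjoint_matrix V ** (V ** diagonal_matrix e ** adjoint_matrix V) ** U" by (simp only: eq)
  moreover have "adjoint_matrix V ** (U ** diagonal_matrix d ** adjoint_matrix U) ** U
     = adjoint_matrix V ** U ** diagonal_matrix d ** (adjoint_matrix U ** U)" by (simp only: matrix_mul_assoc)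
  moreover have "adjoint_matrix V ** (V ** diagonal_matrix e ** adjoint_matrix V) ** U
     = (adjoint_matrix V ** V) ** diagonal_matrix e ** (adjoint_matrix V ** U)" by (simp only: matrix_mul_assoc)
  ultimately have "W ** diagonal_matrix d = diagonal_matrix e ** W"
    by (simp add: W_def unitary_adjoint_mult[OF U] unitary_adjoint_mult[OF V])
  then have "W $ i $ j * of_real (d j) = of_real (e i) * W $ i $ j" for i j
    by (simp add: vec_eq_iff mult_diagonal_nth diagonal_mult_nth)
  then have "W $ i $ j = 0 \<or> d j = e i" for i j
    by (metis mult.commute mult_cancel_left of_real_eq_iff)
  then have "W $ i $ j * of_real (f (d j)) = of_real (f (e i)) * W $ i $ j" for i j
    by (metis mult.commute mult_zero_left)
  then have "W ** diagonal_matrix (\<lambda>i. f (d i)) = diagonal_matrix (\<lambda>i. f (e i)) ** W"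
    by (simp add: vec_eq_iff mult_diagonal_nth diagonal_mult_nth)
  then have "V ** (W ** diagonal_matrix (\<lambda>i. f (d i))) ** adjoint_matrix U
      = V ** (diagonal_matrix (\<lambda>i. f (e i)) ** W) ** adjoint_matrix U" by simp
  then show ?thesis by (simp only: matrix_mul_assoc flip: UW) (simp only: VW matrix_mul_assoc)
qed

lemma psd_power_spectral:
  assumes "unitary_matrix U" "\<And>i. 0 \<le> d i"
  shows "psd_power (U ** diagonal_matrix d ** adjoint_matrix U) r
       = U ** diagonal_matrix (\<lambda>i. d i powr r) ** adjoint_matrix U"
  unfolding psd_power_def
proof (rule the_equality)
  fix B assume "\<exists>V e. unitary_matrix V \<and> (\<forall>i. 0 \<le> e i) \<and>
     U ** diagonal_matrix d ** adjoint_matrix U = V ** diagonal_matrix e ** adjoint_matrix V \<and>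
     B = V ** diagonal_matrix (\<lambda>i. e i powr r) ** adjoint_matrix V"
  then obtain V e where V: "unitary_matrix V"
    and eq: "U ** diagonal_matrix d ** adjoint_matrix U = V ** diagonal_matrix e ** adjoint_matrix V"
    and B: "B = V ** diagonal_matrix (\<lambda>i. e i powr r) ** adjoint_matrix V" by (elim exE conjE)
  show "B = U ** diagonal_matrix (\<lambda>i. d i powr r) ** adjoint_matrix U"
    unfolding B by (rule spectral_function_unique[OF assms(1) V eq, symmetric])
qed (use assms in blast)

lemma pos_semidef_spectral:
  assumes "unitary_matrix U" "\<And>i. 0 \<le> d i"
  shows "pos_semidef (U ** diagonal_matrix d ** adjoint_matrix U)"
  unfolding pos_semidef_iff
proof (intro conjI allI)
  show "adjoint_matrix (U ** diagonal_matrix d ** adjoint_matrix U) = U ** diagonal_matrix d ** adjoint_matrix U"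
    by (simp add: adjoint_matrix_mult matrix_mul_assoc)
  fix v
  define w where "w = adjoint_matrix U *v v"
  have "hdot v ((U ** diagonal_matrix d ** adjoint_matrix U) *v v) = hdot w (diagonal_matrix d *v w)"
    by (simp add: w_def hdot_adjoint flip: matrix_vector_mul_assoc)
  also have "Re \<dots> = (\<Sum>i\<in>UNIV. d i * (norm (w $ i))\<^sup>2)"
    unfolding hdot_def Re_sum
    by (intro sum.cong refl)
       (simp add: diagonal_mult_vec_nth cmod_def algebra_simps power2_eq_square)
  also have "0 \<le> \<dots>" by (intro sum_nonneg mult_nonneg_nonneg assms) simp
  finally show "0 \<le> Re (hdot v ((U ** diagonal_matrix d ** adjoint_matrix U) *v v))" .
qed

lemma scaleR_spectral:
  "c *\<^sub>R (U ** diagonal_matrix d ** adjoint_matrix U) = U ** diagonal_matrix (\<lambda>i. c * d i) ** adjoint_matrix U"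
  by (simp add: vec_eq_iff matrix_matrix_mult_def[of _ "adjoint_matrix U"] mult_diagonal_nth sum_distrib_left
      scaleR_conv_of_real[where 'a=complex] mult_ac)

lemma psd_power_scaleR:
  assumes "pos_semidef A" "0 \<le> c"
  shows "psd_power (c *\<^sub>R A) r = (c powr r) *\<^sub>R psd_power A r"
proof -
  obtain U d where U: "unitary_matrix U" and d: "\<And>i. 0 \<le> d i"
    and A: "A = U ** diagonal_matrix d ** adjoint_matrix U" using psd_spectral[OF assms(1)] by metis
  show ?thesis
    unfolding A scaleR_spectral using d assms(2)
    by (subst (1 2) psd_power_spectral[OF U]) (simp_all add: scaleR_spectral powr_mult)
qed

text \<open>Both kernels consist of the vectors whose coordinates in an eigenbasis vanish wherever the
  eigenvalue does not.\<close>

lemma psd_power_vec_zero_iff: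
  assumes "pos_semidef A"
  shows "psd_power A r *v x = 0 \<longleftrightarrow> A *v x = 0"
proof -
  obtain U d where U: "unitary_matrix U" and d: "\<And>i. 0 \<le> d i"
    and A: "A = U ** diagonal_matrix d ** adjoint_matrix U" using psd_spectral[OF assms(1)] by metis
  have *: "(U ** diagonal_matrix e ** adjoint_matrix U) *v x = 0
      \<longleftrightarrow> (\<forall>i. e i = 0 \<or> (adjoint_matrix U *v x) $ i = 0)" for e
  proof -
    have "(U ** diagonal_matrix e ** adjoint_matrix U) *v x = 0
        \<longleftrightarrow> diagonal_matrix e *v (adjoint_matrix U *v x) = 0"
      using unitary_norm[OF U, of "diagonal_matrix e *v (adjoint_matrix U *v x)"]
      by (metis matrix_vector_mul_assoc norm_eq_zero)
    then show ?thesis by (simp add: vec_eq_iff diagonal_mult_vec_nth)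
  qed
  show ?thesis unfolding A psd_power_spectral[OF U d] * by simp
qed

text \<open>For Hermitian matrices the kernel is the orthogonal complement of the range, and \<open>A\<close> and its
  range projection have the same range. Together with the previous lemma this turns
  \<open>M\<close>-equivalence of functions into equality of their weighted versions.\<close>

lemma range_projection_vec_zero_iff:
  assumes psd: "pos_semidef A"
  shows "range_projection A *v x = 0 \<longleftrightarrow> A *v x = 0"
proof -
  have herm: "adjoint_matrix A = A" using psd by (simp add: pos_semidef_def)
  obtain U d where U: "unitary_matrix U" and d: "\<And>i. 0 \<le> d i"
    and A: "A = U ** diagonal_matrix d ** adjoint_matrix U" using psd_spectral[OF assms(1)] by metis
  let ?is_proj = "\<lambda>P. P ** P = P \<and> adjoint_matrix P = P \<and> range ((*v) P) = range ((*v) A)"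
  have mult: "(U ** diagonal_matrix a ** adjoint_matrix U) ** (U ** diagonal_matrix b ** adjoint_matrix U)
      = U ** diagonal_matrix (\<lambda>i. a i * b i) ** adjoint_matrix U" for a b
  proof -
    have "(U ** diagonal_matrix a ** adjoint_matrix U) ** (U ** diagonal_matrix b ** adjoint_matrix U)
      = U ** diagonal_matrix a ** (adjoint_matrix U ** U) ** diagonal_matrix b ** adjoint_matrix U"
      by (simp only: matrix_mul_assoc)
    then show ?thesis
      by (simp add: unitary_adjoint_mult[OF U]) (simp add: diagonal_mult_diagonal flip: matrix_mul_assoc)
  qed
  \<comment> \<open>The projection is the spectral function that maps nonzero eigenvalues to 1.\<close>
  define P where "P = U ** diagonal_matrix (\<lambda>i. if d i = 0 then 0 else 1) ** adjoint_matrix U"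
  have "P ** P = P" unfolding P_def mult by (intro arg_cong2[where f="(**)"] refl arg_cong[where f=diagonal_matrix]) auto
  moreover have "adjoint_matrix P = P"
    by (simp add: P_def adjoint_matrix_mult matrix_mul_assoc)
  moreover have "P ** A = A"
    unfolding P_def A mult by (intro arg_cong2[where f="(**)"] refl arg_cong[where f=diagonal_matrix]) auto
  \<comment> \<open>As \<open>inverse 0 = 0\<close>, the second factor inverts \<open>A\<close> on its range.\<close>
  moreover have "A ** (U ** diagonal_matrix (\<lambda>i. inverse (d i)) ** adjoint_matrix U) = P"
    unfolding P_def A mult by (intro arg_cong2[where f="(**)"] refl arg_cong[where f=diagonal_matrix]) auto
  then have "range ((*v) P) \<subseteq> range ((*v) A)"
    by (metis (no_types, lifting) image_subsetI matrix_vector_mul_assoc rangeI)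
  moreover have "range ((*v) A) \<subseteq> range ((*v) P)"
    using \<open>P ** A = A\<close> by (metis (no_types, lifting) image_subsetI matrix_vector_mul_assoc rangeI)
  ultimately have P: "?is_proj P" by auto
  have "range_projection A = P"
    unfolding range_projection_def
  proof (rule the_equality)
    show "?is_proj P" by (rule P)
  next
    fix Q assume Q: "?is_proj Q"
    have absorb: "R ** R' = R'" if R: "?is_proj R" and R': "?is_proj R'" for R R'
    proof -
      have "R *v (R' *v x) = R' *v x" for x
      proof -
        have "R' *v x \<in> range ((*v) R)" using R R' by auto
        then obtain y where "R' *v x = R *v y" by auto
        then show ?thesis using R by (simp add: matrix_vector_mul_assoc)
      qed
      then show ?thesis by (simp add: matrix_eq matrix_vector_mul_assoc)
    qed
    have "adjoint_matrix (P ** Q) = adjoint_matrix Q" using absorb[OF P Q] by simp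
    then have "Q ** P = Q" using P Q by (simp add: adjoint_matrix_mult)
    then show "Q = P" using absorb[OF Q P] by simp
  qed
  moreover have "P *v x = 0 \<longleftrightarrow> A *v x = 0"
  proof -
    have P': "adjoint_matrix P = P" "range ((*v) P) = range ((*v) A)" using P by auto
    show ?thesis
    proof
      assume Px: "P *v x = 0"
      obtain z where z: "A *v (A *v x) = P *v z" using P'(2) by blast
      have "hdot (A *v x) (A *v x) = hdot x (A *v (A *v x))" using hdot_adjoint[of A x] by (simp add: herm)
      also have "\<dots> = hdot (P *v x) z" unfolding z using hdot_adjoint[of P x z] by (simp add: P')
      also have "\<dots> = 0" by (simp add: Px hdot_def)
      finally show "A *v x = 0" by (simp add: hdot_self)
    next
      assume Ax: "A *v x = 0"
      obtain z where z: "P *v (P *v x) = A *v z" using P'(2) by blast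
      have "hdot (P *v x) (P *v x) = hdot x (P *v (P *v x))" using hdot_adjoint[of P x] by (simp add: P')
      also have "\<dots> = hdot (A *v x) z" unfolding z using hdot_adjoint[of A x z] by (simp add: herm)
      also have "\<dots> = 0" by (simp add: Ax hdot_def)
      finally show "P *v x = 0" by (simp add: hdot_self)
    qed
  qed
  ultimately show ?thesis by simp
qed

lemma trace_spectral:
  assumes U: "unitary_matrix U"
  shows "trace (U ** diagonal_matrix d ** adjoint_matrix U) = of_real (\<Sum>i\<in>UNIV. d i)"
proof -
  have "trace (U ** diagonal_matrix d ** adjoint_matrix U) = trace (adjoint_matrix U ** (U ** diagonal_matrix d))"
    by (rule trace_mul_sym)
  also have "\<dots> = trace (diagonal_matrix d)" by (simp add: matrix_mul_assoc unitary_adjoint_mult[OF U])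
  finally show ?thesis by (simp add: trace_def)
qed

text \<open>Every eigenvalue is at most the trace. Applied with exponent \<open>1 / \<alpha>\<close>, this bound makes bounded
  functions \<open>\<alpha>\<close>-integrable, because the trace of a derivative is integrable.\<close>

lemma norm_psd_power_vec_le:
  assumes "pos_semidef A" "0 < r"
  shows "norm (psd_power A r *v x) \<le> Re (trace A) powr r * norm x"
proof -
  obtain U d where U: "unitary_matrix U" and d: "\<And>i. 0 \<le> d i"
    and A: "A = U ** diagonal_matrix d ** adjoint_matrix U" using psd_spectral[OF assms(1)] by metis
  define t where "t = Re (trace A)"
  have "d i \<le> t" for i
    using member_le_sum[of i UNIV d] d by (simp add: t_def A trace_spectral[OF U])
  then have *: "d i powr r \<le> t powr r" for i using d assms(2) by (simp add: powr_mono2)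
  define w where "w = adjoint_matrix U *v x"
  have "norm (psd_power A r *v x) = norm (diagonal_matrix (\<lambda>i. d i powr r) *v w)"
    unfolding A psd_power_spectral[OF U d] w_def
    by (simp add: unitary_norm[OF U] flip: matrix_vector_mul_assoc)
  also have "\<dots> \<le> norm ((t powr r) *\<^sub>R w)"
    by (rule norm_le_componentwise_cart)
       (simp add: diagonal_mult_vec_nth norm_mult * mult_right_mono)
  also have "\<dots> = t powr r * norm x"
    by (simp add: w_def unitary_norm[OF unitary_adjoint[OF U]])
  finally show ?thesis by (simp add: t_def)
qed

lemma trace_pos_semidef_nonneg: "pos_semidef A \<Longrightarrow> 0 \<le> Re (trace A)"
  by (metis (no_types) psd_spectral trace_spectral Re_complex_of_real sum_nonneg)

lemma pos_semidef_trace_zero: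
  assumes "pos_semidef A" "Re (trace A) = 0"
  shows "A = 0"
proof -
  obtain U d where U: "unitary_matrix U" and d: "\<And>i. 0 \<le> d i"
    and A: "A = U ** diagonal_matrix d ** adjoint_matrix U" using psd_spectral[OF assms(1)] by metis
  have "(\<Sum>i\<in>UNIV. d i) = 0" using assms(2) by (simp add: A trace_spectral[OF U])
  then have "d = (\<lambda>i. 0 * d i)" using d by (simp add: sum_nonneg_eq_0_iff fun_eq_iff)
  then have "A = 0 *\<^sub>R (U ** diagonal_matrix d ** adjoint_matrix U)"
    unfolding scaleR_spectral A by (simp only:)
  then show ?thesis by simp
qed

primrec mpow :: "complex^'n^'n \<Rightarrow> nat \<Rightarrow> complex^'n^'n" where
  "mpow A 0 = mat 1"
| "mpow A (Suc k) = A ** mpow A k"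

lemma mpow_spectral:
  assumes U: "unitary_matrix U"
  shows "mpow (U ** diagonal_matrix d ** adjoint_matrix U) k = U ** diagonal_matrix (\<lambda>i. d i ^ k) ** adjoint_matrix U"
proof (induction k)
  case 0
  then show ?case by (simp add: diagonal_one unitary_mult_adjoint[OF U])
next
  case (Suc k)
  have "mpow (U ** diagonal_matrix d ** adjoint_matrix U) (Suc k)
    = U ** diagonal_matrix d ** (adjoint_matrix U ** U) ** diagonal_matrix (\<lambda>i. d i ^ k) ** adjoint_matrix U"
    by (simp add: Suc.IH matrix_mul_assoc)
  also have "\<dots> = U ** (diagonal_matrix d ** diagonal_matrix (\<lambda>i. d i ^ k)) ** adjoint_matrix U"
    by (simp add: unitary_adjoint_mult[OF U] matrix_mul_assoc)
  finally show ?case by (simp add: diagonal_mult_diagonal)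
qed

lemma continuous_on_mpow: "continuous_on S (\<lambda>A. mpow A k)"
  by (induction k) (auto simp: matrix_matrix_mult_def intro!: continuous_intros)

lemma closed_pos_semidef: "closed {A :: complex^'q^'q. pos_semidef A}"
proof -
  have "{A :: complex^'q^'q. pos_semidef A}
     = {A. adjoint_matrix A = A} \<inter> (\<Inter>v. {A. 0 \<le> Re (hdot v (A *v v))})"
    by (auto simp: pos_semidef_iff)
  moreover have "closed {A :: complex^'q^'q. adjoint_matrix A = A}"
    unfolding adjoint_matrix_def by (intro closed_Collect_eq continuous_intros)
  moreover have "closed {A :: complex^'q^'q. 0 \<le> Re (hdot v (A *v v))}" for v
    unfolding hdot_def by (intro closed_Collect_le continuous_intros)
  ultimately show ?thesis by (simp add: closed_INT closed_Int)
qed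

lemma polynomial_approx_powr:
  fixes r :: real assumes "0 < r"
  shows "\<exists>N a. \<forall>x\<in>{0..real n}. \<bar>x powr r - (\<Sum>k\<le>N. a k * x ^ k)\<bar> < 1 / (1 + real n)"
proof -
  have "continuous_on {0..real n} (\<lambda>x. x powr r)"
    using assms by (intro continuous_on_powr') (auto intro!: continuous_intros)
  then obtain g where g: "real_polynomial_function g"
    "\<And>x. x \<in> {0..real n} \<Longrightarrow> \<bar>x powr r - g x\<bar> < 1 / (1 + real n)"
    using Stone_Weierstrass_real_polynomial_function[of "{0..real n}" "\<lambda>x. x powr r" "1 / (1 + real n)"]
    by auto
  obtain N a where "g = (\<lambda>x. \<Sum>k\<le>N. a k * x ^ k)"
    using g(1) unfolding real_polynomial_function_iff_sum by blast
  then show ?thesis using g(2) by blast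
qed

text \<open>A power of a positive semidefinite matrix is a pointwise limit of matrix polynomials, by the
  Weierstrass theorem on the intervals \<open>[0, n]\<close>, and matrix polynomials are continuous.\<close>

lemma measurable_psd_power:
  assumes "0 < r"
  shows "(\<lambda>A :: complex^'q^'q. psd_power A r) \<in> borel_measurable borel"
proof -
  \<comment> \<open>The constant value of the power off the closed set of positive semidefinite matrices.\<close>
  define Z where "Z = (THE B :: complex^'q^'q. False)"
  obtain N a where appr: "\<And>n x. 0 \<le> x \<Longrightarrow> x \<le> real n \<Longrightarrow>
      \<bar>x powr r - (\<Sum>k\<le>N n. a n k * x ^ k)\<bar> < 1 / (1 + real n)"
    using polynomial_approx_powr[OF assms] by (metis atLeastAtMost_iff)
  define p where "p n A = (if pos_semidef A then (\<Sum>k\<le>N n. a n k *\<^sub>R mpow A k) else Z)" for n and A :: "complex^'q^'q"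
  show ?thesis
  proof (rule borel_measurable_LIMSEQ_metric)
    show "p n \<in> borel_measurable borel" for n
      unfolding p_def
      by (intro measurable_If borel_measurable_continuous_onI continuous_intros continuous_on_mpow)
         (use closed_pos_semidef in \<open>auto intro: borel_closed\<close>)
  next
    fix A :: "complex^'q^'q"
    show "(\<lambda>n. p n A) \<longlonglongrightarrow> psd_power A r"
    proof (cases "pos_semidef A")
      case True
      obtain U d where U: "unitary_matrix U" and d: "\<And>i. 0 \<le> d i"
        and A: "A = U ** diagonal_matrix d ** adjoint_matrix U" using psd_spectral[OF True] by metis
      have p: "p n A = U ** diagonal_matrix (\<lambda>i. \<Sum>k\<le>N n. a n k * d i ^ k) ** adjoint_matrix U" for n
        using True
        by (simp add: p_def A mpow_spectral[OF U] scaleR_spectral)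
           (simp add: vec_eq_iff matrix_matrix_mult_def[of _ "adjoint_matrix U"] mult_diagonal_nth
             sum_distrib_left sum_distrib_right sum.swap[of _ _ UNIV])
      have lim: "(\<lambda>n. \<Sum>k\<le>N n. a n k * d i ^ k) \<longlonglongrightarrow> d i powr r" for i
      proof (rule LIM_zero_cancel, rule Lim_null_comparison)
        show "(\<lambda>n. 1 / (1 + real n)) \<longlonglongrightarrow> 0" using LIMSEQ_inverse_real_of_nat by (simp add: inverse_eq_divide add.commute)
        show "\<forall>\<^sub>F n in sequentially. norm ((\<Sum>k\<le>N n. a n k * d i ^ k) - d i powr r) \<le> 1 / (1 + real n)"
          using eventually_ge_at_top[of "nat \<lceil>d i\<rceil>"]
        proof eventually_elim
          case (elim n)
          then have "d i \<le> real n" by linarith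
          from appr[OF d this] show ?case by (simp add: abs_minus_commute)
        qed
      qed
      show ?thesis
      proof -
        have pw: "psd_power A r = U ** diagonal_matrix (\<lambda>i. d i powr r) ** adjoint_matrix U"
          unfolding A by (rule psd_power_spectral[OF U d])
        have "(\<lambda>n. p n A $ i $ j) \<longlonglongrightarrow> psd_power A r $ i $ j" for i j
          unfolding p pw matrix_matrix_mult_def[of _ "adjoint_matrix U"] mult_diagonal_nth vec_lambda_beta
          by (intro tendsto_intros lim)
        then show ?thesis by (intro vec_tendstoI)
      qed
    next
      case False
      have "psd_power A r = Z"
        unfolding psd_power_def Z_def using False pos_semidef_spectral by (intro arg_cong[where f=The]) blast
      then show ?thesis using False by (simp add: p_def)
    qed
  qed
qed

lemma pos_semidef_scaleR: "pos_semidef X \<Longrightarrow> 0 \<le> c \<Longrightarrow> pos_semidef (c *\<^sub>R X)"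
  by (auto simp: pos_semidef_iff scaleR_matrix_vector hdot_scaleR_right adjoint_matrix_def vec_eq_iff)

lemma pos_semidef_zero: "pos_semidef 0"
  by (simp add: pos_semidef_iff adjoint_matrix_def vec_eq_iff) (simp add: hdot_def)

lemma pos_semidef_add_zero:
  assumes "pos_semidef X" "pos_semidef Y" "X + Y = 0"
  shows "X = 0"
proof (rule pos_semidef_trace_zero[OF assms(1)])
  have "Re (trace X) + Re (trace Y) = 0" using arg_cong[OF assms(3), of "\<lambda>Z. Re (trace Z)"] by (simp add: trace_add) (simp add: trace_def)
  then show "Re (trace X) = 0"
    using trace_pos_semidef_nonneg[OF assms(1)] trace_pos_semidef_nonneg[OF assms(2)] by linarith
qed

text \<open>Diagonal entries are the values of the quadratic form at the standard basis vectors.\<close>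

lemma pos_semidef_nth_diag:
  assumes "pos_semidef X"
  shows "X $ i $ i = of_real (Re (X $ i $ i))" "0 \<le> Re (X $ i $ i)"
proof -
  have "cnj (X $ i $ i) = X $ i $ i" using assms unfolding pos_semidef_def adjoint_matrix_def vec_eq_iff by simp
  then show "X $ i $ i = of_real (Re (X $ i $ i))"
    by (metis Reals_cnj_iff of_real_Re)
  have "hdot (axis i 1) (X *v axis i 1) = X $ i $ i"
    by (simp add: hdot_def axis_def matrix_vector_mult_def if_distrib if_distribR cong: if_cong)
  then show "0 \<le> Re (X $ i $ i)" using assms by (metis pos_semidef_iff)
qed

lemma psd_power_zero: "psd_power 0 r = (0 :: complex^'q^'q)"
  using psd_power_scaleR[OF pos_semidef_zero, of 0 r] by simp

lemma measurable_psd_power_vec: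
  fixes D :: "'w \<Rightarrow> complex^'q^'q"
  assumes "0 < r" "D \<in> borel_measurable T" "f \<in> borel_measurable T"
  shows "(\<lambda>x. psd_power (D x) r *v f x) \<in> borel_measurable T"
proof (rule borel_measurable_continuous_Pair[of _ _ _ "\<lambda>X v. X *v v"])
  show "(\<lambda>x. psd_power (D x) r) \<in> borel_measurable T"
    by (rule measurable_compose[OF assms(2) measurable_psd_power[OF assms(1)]])
  show "continuous_on UNIV (\<lambda>x :: (complex^'q^'q) \<times> (complex^'q). fst x *v snd x)"
    by (intro continuous_intros)
qed (rule assms)

section \<open>Scalar measures obtained from a matrix measure\<close>

definition nonneg_measure :: "'w measure \<Rightarrow> ('w set \<Rightarrow> real) \<Rightarrow> 'w measure"
  where "nonneg_measure N F = measure_of (space N) (sets N) (\<lambda>B. ennreal (F B))"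

lemma space_nonneg_measure [simp]: "space (nonneg_measure N F) = space N"
  and sets_nonneg_measure [simp, measurable_cong]: "sets (nonneg_measure N F) = sets N"
  by (simp_all add: nonneg_measure_def)

lemma vector_measure_Un:
  assumes M: "vector_measure N M" and sets: "B \<in> sets N" "C \<in> sets N" "B \<inter> C = {}"
  shows "M (B \<union> C) = M B + M C"
proof -
  have "range (binaryset B C) \<subseteq> sets N" using sets by (simp add: range_binaryset_eq)
  moreover have "disjoint_family (binaryset B C)"
    using sets(3) unfolding disjoint_family_on_def binaryset_def by (simp add: Int_commute)
  ultimately have "(\<lambda>i. M (binaryset B C i)) sums M (\<Union>i. binaryset B C i)"
    using M unfolding vector_measure_def by blast
  moreover have "(\<lambda>i. M (binaryset B C i)) sums (M B + M C)"
    using M by (intro binaryset_sums) (simp add: vector_measure_def)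
  ultimately show ?thesis unfolding UN_binaryset_eq by (rule sums_unique2)
qed

lemma vector_measure_split:
  assumes M: "vector_measure N M" and sets: "B \<in> sets N" "C \<in> sets N"
  shows "M B = M (B \<inter> C) + M (B - C)"
proof -
  have "B \<inter> C \<inter> (B - C) = {}" "B \<inter> C \<union> (B - C) = B" by blast+
  then show ?thesis using vector_measure_Un[OF M, of "B \<inter> C" "B - C"] sets by simp
qed

text \<open>A linear functional that is nonnegative on positive semidefinite matrices turns a matrix measure
  into a finite measure. It is used for the values of quadratic forms, the trace and the diagonal entries.\<close>

lemma emeasure_nonneg_measure:
  assumes M: "psd_measure N M" and L: "linear L" "\<And>X. pos_semidef X \<Longrightarrow> 0 \<le> L X" and B: "B \<in> sets N"
  shows "emeasure (nonneg_measure N (\<lambda>B. L (M B))) B = ennreal (L (M B))"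
proof (rule emeasure_measure_of[OF nonneg_measure_def])
  have vm: "vector_measure N M" and psd: "\<And>B. B \<in> sets N \<Longrightarrow> pos_semidef (M B)"
    using M by (auto simp: psd_measure_def)
  show "positive (sets (nonneg_measure N (\<lambda>B. L (M B)))) (\<lambda>B. ennreal (L (M B)))"
    using vm by (simp add: positive_def vector_measure_def linear_0[OF L(1)])
  show "countably_additive (sets (nonneg_measure N (\<lambda>B. L (M B)))) (\<lambda>B. ennreal (L (M B)))"
  proof (rule countably_additiveI)
    fix A :: "nat \<Rightarrow> _" assume A: "range A \<subseteq> sets (nonneg_measure N (\<lambda>B. L (M B)))" "disjoint_family A"
    have "(\<lambda>i. M (A i)) sums M (\<Union>i. A i)" using vm A by (simp add: vector_measure_def)
    from bounded_linear.sums[OF L(1)[unfolded linear_conv_bounded_linear] this]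
    have "(\<lambda>i. L (M (A i))) sums L (M (\<Union>i. A i))" .
    moreover have "0 \<le> L (M (A i))" for i using A(1) by (intro L(2) psd) auto
    ultimately show "(\<Sum>i. ennreal (L (M (A i)))) = ennreal (L (M (\<Union>i. A i)))"
      by (rule suminf_ennreal_eq[rotated])
  qed
qed (use B in \<open>simp_all add: sets.space_closed\<close>)

lemma linear_quadratic_form: "linear (\<lambda>X. Re (hdot v (X *v v)))"
  by (rule linearI)
     (simp_all add: matrix_vector_mult_add_rdistrib hdot_add_right scaleR_matrix_vector hdot_scaleR_right)

lemma linear_Re_trace: "linear (\<lambda>X :: complex^'q^'q. Re (trace X))"
  by (rule linearI) (simp_all add: trace_def sum.distrib sum_distrib_left)

lemma psd_quadratic_form: "pos_semidef X \<Longrightarrow> 0 \<le> Re (hdot v (X *v v))"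
  by (simp add: pos_semidef_iff)

text \<open>Matrix entries are combinations of values of the quadratic form. Densities of the nonnegative measures
  \<open>B \<mapsto> \<langle>v, M B v\<rangle>\<close> therefore determine a density of the whole matrix measure.\<close>

lemma polarization:
  assumes "adjoint_matrix X = X"
  shows "Re (c * X $ i $ j) = (Re (hdot (axis i 1 + c *s axis j 1) (X *v (axis i 1 + c *s axis j 1)))
     - Re (hdot (axis i 1 - c *s axis j 1) (X *v (axis i 1 - c *s axis j 1)))) / 4"
proof -
  have real: "inner (x + y) (X *v (x + y)) - inner (x - y) (X *v (x - y)) = 4 * inner x (X *v y)" for x y
    using hermitian_inner[OF assms, of x y]
    by (simp add: matrix_vector_right_distrib matrix_vector_mult_diff_distrib inner_add_left inner_add_right
        inner_diff_left inner_diff_right inner_commute)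
  have "hdot (axis i 1) (X *v (c *s axis j 1)) = c * X $ i $ j"
  proof -
    have "hdot (axis i 1) (X *v (c *s axis j 1)) = c * (X *v axis j 1) $ i"
      by (simp add: vec.scale hdot_smult_right)
         (simp add: hdot_def axis_def if_distrib if_distribR cong: if_cong)
    then show ?thesis by (simp add: matrix_vector_mul_component inner_axis matrix_vector_mult_def axis_def if_distrib cong: if_cong)
  qed
  then have "Re (c * X $ i $ j) = inner (axis i 1) (X *v (c *s axis j 1))" by (simp flip: Re_hdot)
  then show ?thesis unfolding Re_hdot using real by simp
qed

section \<open>Radon-Nikodym derivatives of matrix measures\<close>

text \<open>The averaging theorem holds for \<open>\<sigma>\<close>-finite measures, whereas a Haar measure need not be one.
  For a cone, the averages may be taken with respect to the finite measure \<open>\<parallel>f\<parallel> dT\<close> instead, for which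
  \<open>f / \<parallel>f\<parallel>\<close> is integrable.\<close>

lemma AE_in_closed_cone:
  fixes f :: "'w \<Rightarrow> 'b::{banach, second_countable_topology}"
  assumes f: "integrable T f" and S: "closed S" "0 \<in> S" "\<And>c x. 0 \<le> c \<Longrightarrow> x \<in> S \<Longrightarrow> c *\<^sub>R x \<in> S"
    and int: "\<And>B. B \<in> sets T \<Longrightarrow> set_lebesgue_integral T B f \<in> S"
  shows "AE x in T. f x \<in> S"
proof -
  define \<eta> where "\<eta> = density T (\<lambda>x. ennreal (norm (f x)))"
  define g where "g x = (1 / norm (f x)) *\<^sub>R f x" for x
  have [measurable]: "f \<in> borel_measurable T" using f by simp
  have [measurable]: "g \<in> borel_measurable T" unfolding g_def by measurable
  have fg: "norm (f x) *\<^sub>R g x = f x" for x by (simp add: g_def)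
  have "emeasure \<eta> (space \<eta>) = (\<integral>\<^sup>+x. ennreal (norm (f x)) \<partial>T)"
    by (simp add: \<eta>_def emeasure_density nn_integral_set_ennreal cong: nn_integral_cong)
  also have "\<dots> < \<infinity>" using f by (simp add: integrable_iff_bounded)
  finally interpret finite_measure \<eta> by (intro finite_measureI) simp
  have "integrable \<eta> g"
    unfolding \<eta>_def using f by (subst integrable_density) (simp_all add: fg)
  moreover have "(1 / measure \<eta> B) *\<^sub>R set_lebesgue_integral \<eta> B g \<in> S" if "B \<in> sets \<eta>" for B
  proof -
    have B[measurable]: "B \<in> sets T" using that by (simp add: \<eta>_def)
    have "set_lebesgue_integral \<eta> B g = (\<integral>x. norm (f x) *\<^sub>R (indicator B x *\<^sub>R g x) \<partial>T)"
      unfolding set_lebesgue_integral_def \<eta>_def by (rule integral_density) simp_all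
    also have "\<dots> = set_lebesgue_integral T B f"
      unfolding set_lebesgue_integral_def
      by (intro Bochner_Integration.integral_cong refl) (metis fg scaleR_left_commute)
    finally show ?thesis using int[OF B] S(3) by simp
  qed
  ultimately have "AE x in \<eta>. g x \<in> S" using S(1) by (intro averaging_theorem) auto
  then have "AE x in T. f x = 0 \<or> g x \<in> S" unfolding \<eta>_def by (simp add: AE_density) (auto elim: eventually_mono)
  then show ?thesis
  proof eventually_elim
    case (elim x)
    then show ?case using S(2) S(3)[of "norm (f x)" "g x"] fg[of x] by auto
  qed
qed

lemma AE_eq_of_set_integrals_eq:
  fixes f g :: "'w \<Rightarrow> 'b::{banach, second_countable_topology}"
  assumes f: "integrable T f" and g: "integrable T g"
    and eq: "\<And>B. B \<in> sets T \<Longrightarrow> set_lebesgue_integral T B f = set_lebesgue_integral T B g"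
  shows "AE x in T. f x = g x"
proof -
  have "AE x in T. f x - g x \<in> {0}"
  proof (rule AE_in_closed_cone)
    fix B assume B: "B \<in> sets T"
    have "set_lebesgue_integral T B (\<lambda>x. f x - g x) = set_lebesgue_integral T B f - set_lebesgue_integral T B g"
      using f g B by (intro set_integral_diff) (simp_all add: set_integrable_def integrable_mult_indicator)
    then show "set_lebesgue_integral T B (\<lambda>x. f x - g x) \<in> {0}" by (simp add: eq[OF B])
  qed (use f g in auto)
  then show ?thesis by simp
qed

text \<open>The positive semidefinite matrices form a closed cone.\<close>

lemma RN_derivative_AE_psd:
  assumes "has_RN_derivative T M D" "psd_measure N M" "sets T = sets N"
  shows "AE x in T. pos_semidef (D x)"
proof -
  have "AE x in T. D x \<in> {X. pos_semidef X}"
    using assms closed_pos_semidef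
    by (intro AE_in_closed_cone)
       (auto simp: has_RN_derivative_def psd_measure_def pos_semidef_zero pos_semidef_scaleR; metis)+
  then show ?thesis by simp
qed

lemma nonneg_functional_density:
  assumes T: "sigma_finite_measure T" "sets T = sets N" and M: "psd_measure N M"
    and ac: "\<And>B. B \<in> sets T \<Longrightarrow> emeasure T B = 0 \<Longrightarrow> M B = 0"
    and L: "linear L" "\<And>X. pos_semidef X \<Longrightarrow> 0 \<le> L X"
  shows "\<exists>g::_ \<Rightarrow> real. integrable T g \<and> (\<forall>B\<in>sets T. L (M B) = set_lebesgue_integral T B g)"
proof -
  interpret sigma_finite_measure T by fact
  define Q where "Q = nonneg_measure N (\<lambda>B. L (M B))"
  have Q: "emeasure Q B = ennreal (L (M B))" if "B \<in> sets N" for B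
    unfolding Q_def by (rule emeasure_nonneg_measure[OF M L that])
  have sets_Q: "sets Q = sets T" by (simp add: Q_def T)
  have L0: "0 \<le> L (M B)" if "B \<in> sets N" for B using M that L(2) by (simp add: psd_measure_def)
  have "absolutely_continuous T Q"
    using ac by (auto simp: absolutely_continuous_def null_sets_def sets_Q T(2) Q linear_0[OF L(1)])
  from Radon_Nikodym[OF this sets_Q] obtain f where f[measurable]: "f \<in> borel_measurable T" and df: "density T f = Q" by blast
  have Qf: "(\<integral>\<^sup>+x. f x * indicator B x \<partial>T) = ennreal (L (M B))" if "B \<in> sets T" for B
    using emeasure_density[OF f that] Q[of B] that by (simp add: df T(2))
  have fin: "AE x in T. f x \<noteq> \<infinity>"
  proof (rule nn_integral_PInf_AE[OF f])
    have "(\<integral>\<^sup>+x. f x \<partial>T) = (\<integral>\<^sup>+x. f x * indicator (space T) x \<partial>T)" by (intro nn_integral_cong) simp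
    then show "integral\<^sup>N T f \<noteq> \<infinity>" using Qf[OF sets.top] by simp
  qed
  define g where "g x = enn2real (f x)" for x
  have [measurable]: "g \<in> borel_measurable T" unfolding g_def by measurable
  have eq: "(\<integral>\<^sup>+x. ennreal (indicator B x * g x) \<partial>T) = ennreal (L (M B))" if "B \<in> sets T" for B
  proof -
    have "(\<integral>\<^sup>+x. ennreal (indicator B x * g x) \<partial>T) = (\<integral>\<^sup>+x. f x * indicator B x \<partial>T)"
      using fin by (intro nn_integral_cong_AE) (auto simp: g_def indicator_def less_top)
    then show ?thesis using Qf that by simp
  qed
  have nn: "0 \<le> g x" for x by (simp add: g_def)
  have "integrable T g"
  proof (rule integrableI_bounded)
    have "(\<integral>\<^sup>+x. ennreal (norm (g x)) \<partial>T) = (\<integral>\<^sup>+x. ennreal (indicator (space T) x * g x) \<partial>T)"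
      by (intro nn_integral_cong) (simp add: nn)
    then show "(\<integral>\<^sup>+x. ennreal (norm (g x)) \<partial>T) < \<infinity>" using eq[OF sets.top] by simp
  qed simp
  moreover have "L (M B) = set_lebesgue_integral T B g" if B[measurable]: "B \<in> sets T" for B
    unfolding set_lebesgue_integral_def real_scaleR_def
    using L0 B T(2) by (subst integral_eq_nn_integral) (simp_all add: nn eq)
  ultimately show ?thesis by blast
qed

text \<open>The scalar Radon-Nikodym theorem applies to the measures \<open>B \<mapsto> \<langle>v, M B v\<rangle>\<close>; polarization assembles
  their densities, one real coordinate of the matrix at a time.\<close>

theorem psd_measure_RN_exists:
  fixes M :: "'w set \<Rightarrow> complex^'q^'q"
  assumes T: "sigma_finite_measure T" "sets T = sets N" and M: "psd_measure N M"
    and ac: "\<And>B. B \<in> sets T \<Longrightarrow> emeasure T B = 0 \<Longrightarrow> M B = 0"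
  shows "\<exists>D. has_RN_derivative T M D"
proof -
  have "\<exists>g. \<forall>v. integrable T (g v) \<and> (\<forall>B\<in>sets T. Re (hdot v (M B *v v)) = set_lebesgue_integral T B (g v))"
    by (intro choice allI nonneg_functional_density[OF T M ac linear_quadratic_form psd_quadratic_form])
  then obtain g :: "complex^'q \<Rightarrow> 'w \<Rightarrow> real" where g: "\<And>v. integrable T (g v)"
    and gM: "\<And>v B. B \<in> sets T \<Longrightarrow> Re (hdot v (M B *v v)) = set_lebesgue_integral T B (g v)" by blast
  have "\<exists>h. integrable T h \<and> (\<forall>B\<in>sets T. inner (M B) b = set_lebesgue_integral T B h)"
    if b: "b \<in> Basis" for b
  proof -
    \<comment> \<open>Here \<open>c\<close> is \<open>1\<close> or \<open>\<i>\<close>, and the coordinate of a matrix along \<open>b\<close> is \<open>Re (cnj c * X $ i $ j)\<close>.\<close>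
    obtain i j c where b: "b = axis i (axis j c)" using b by (auto simp: Basis_vec_def)
    define v w where "v = axis i 1 + cnj c *s axis j 1" and "w = axis i 1 - cnj c *s axis j 1"
    have "inner (M B) b = set_lebesgue_integral T B (\<lambda>x. (g v x - g w x) / 4)" if B: "B \<in> sets T" for B
    proof -
      have "inner (M B) b = Re (cnj c * M B $ i $ j)" by (simp add: b inner_axis inner_complex_def)
      also have "\<dots> = (Re (hdot v (M B *v v)) - Re (hdot w (M B *v w))) / 4"
        unfolding v_def w_def using M B T(2) by (intro polarization) (simp add: psd_measure_def pos_semidef_def)
      also have "\<dots> = set_lebesgue_integral T B (\<lambda>x. (g v x - g w x) / 4)"
      proof -
        have "set_integrable T B (g v)" "set_integrable T B (g w)"
          using integrable_mult_indicator[OF B g] by (simp_all add: set_integrable_def)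
        from set_integral_diff(2)[OF this] show ?thesis by (simp add: gM[OF B])
      qed
      finally show ?thesis .
    qed
    then show ?thesis using g by (intro exI[of _ "\<lambda>x. (g v x - g w x) / 4"]) auto
  qed
  then obtain h where h: "\<And>b. b \<in> Basis \<Longrightarrow> integrable T (h b)"
    and hM: "\<And>b B. b \<in> Basis \<Longrightarrow> B \<in> sets T \<Longrightarrow> inner (M B) b = set_lebesgue_integral T B (h b)" by metis
  define D where "D x = (\<Sum>b\<in>Basis. h b x *\<^sub>R b)" for x
  have "integrable T D" unfolding D_def using h by (intro Bochner_Integration.integrable_sum) auto
  moreover have "M B = set_lebesgue_integral T B D" if B: "B \<in> sets T" for B
  proof -
    have hi: "integrable T (\<lambda>x. indicator B x * h b x)" if "b \<in> Basis" for b
      using integrable_mult_indicator[OF B h[OF that]] by simp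
    have "set_lebesgue_integral T B D = (\<integral>x. (\<Sum>b\<in>Basis. (indicator B x * h b x) *\<^sub>R b) \<partial>T)"
      unfolding set_lebesgue_integral_def D_def by (simp add: scaleR_sum_right)
    also have "\<dots> = (\<Sum>b\<in>Basis. (\<integral>x. (indicator B x * h b x) *\<^sub>R b \<partial>T))"
      using hi by (intro Bochner_Integration.integral_sum integrable_scaleR_left)
    also have "\<dots> = (\<Sum>b\<in>Basis. inner (M B) b *\<^sub>R b)"
      using hM B by (intro sum.cong refl) (simp add: set_lebesgue_integral_def hi)
    finally show ?thesis by (simp add: euclidean_representation)
  qed
  ultimately show ?thesis unfolding has_RN_derivative_def by blast
qed

lemma has_RN_derivative_RN_derivative:
  "\<exists>D. has_RN_derivative T M D \<Longrightarrow> has_RN_derivative T M (RN_derivative T M)"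
  unfolding RN_derivative_def by (rule someI_ex[where P = "has_RN_derivative T M"])

lemma set_integral_linear:
  fixes L :: "'b::euclidean_space \<Rightarrow> real"
  assumes "integrable T D" "B \<in> sets T" "linear L"
  shows "set_lebesgue_integral T B (\<lambda>x. L (D x)) = L (set_lebesgue_integral T B D)"
proof -
  have bl: "bounded_linear L" using assms(3) by (simp add: linear_linear)
  show ?thesis
    unfolding set_lebesgue_integral_def
    using integral_bounded_linear[OF bl integrable_mult_indicator[OF assms(2,1)]]
    by (simp add: linear_scale[OF assms(3)])
qed

section \<open>Independence of the dominating measure\<close>

text \<open>The trace of \<open>M\<close> is a finite scalar measure determined by \<open>M\<close> alone that dominates \<open>M\<close>. All weighted
  integrals are compared with the one formed with it.\<close>

abbreviation trace_measure :: "'w measure \<Rightarrow> ('w set \<Rightarrow> complex^'q^'q) \<Rightarrow> 'w measure"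
  where "trace_measure N M \<equiv> nonneg_measure N (\<lambda>B. Re (trace (M B)))"

lemma emeasure_trace_measure:
  "psd_measure N M \<Longrightarrow> B \<in> sets N \<Longrightarrow> emeasure (trace_measure N M) B = ennreal (Re (trace (M B)))"
  by (rule emeasure_nonneg_measure[OF _ linear_Re_trace trace_pos_semidef_nonneg])

lemma trace_measure_eq_density:
  assumes D: "has_RN_derivative T M D" and M: "psd_measure N M" and sets: "sets T = sets N"
  shows "trace_measure N M = density T (\<lambda>x. ennreal (Re (trace (D x))))"
proof (rule measure_eqI)
  have int: "integrable T D" using D by (simp add: has_RN_derivative_def)
  then have int': "integrable T (\<lambda>x. Re (trace (D x)))"
    using integrable_bounded_linear linear_Re_trace linear_linear by blast
  then have [measurable]: "(\<lambda>x. Re (trace (D x))) \<in> borel_measurable T" by simp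
  have nn: "AE x in T. 0 \<le> Re (trace (D x))"
    using RN_derivative_AE_psd[OF assms] by eventually_elim (rule trace_pos_semidef_nonneg)
  fix B assume "B \<in> sets (trace_measure N M)"
  then have B[measurable]: "B \<in> sets T" and B': "B \<in> sets N" using sets by simp_all
  have "ennreal (Re (trace (M B))) = ennreal (set_lebesgue_integral T B (\<lambda>x. Re (trace (D x))))"
    using D B set_integral_linear[OF int B linear_Re_trace] by (simp add: has_RN_derivative_def)
  also have "\<dots> = (\<integral>\<^sup>+x. ennreal (indicator B x * Re (trace (D x))) \<partial>T)"
    unfolding set_lebesgue_integral_def real_scaleR_def
    by (rule nn_integral_eq_integral[symmetric])
       (use nn integrable_mult_indicator[OF B int'] in \<open>auto elim!: eventually_mono\<close>)
  also have "\<dots> = emeasure (density T (\<lambda>x. ennreal (Re (trace (D x))))) B"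
    by (subst emeasure_density) (auto intro!: nn_integral_cong simp: indicator_def)
  finally show "emeasure (trace_measure N M) B = emeasure (density T (\<lambda>x. ennreal (Re (trace (D x))))) B"
    using emeasure_trace_measure[OF M B'] by simp
qed (simp add: sets)

text \<open>A positive semidefinite matrix with zero trace is zero, so \<open>M\<close> is absolutely continuous with respect
  to its trace.\<close>

lemma trace_measure_RN_exists:
  assumes "psd_measure N M"
  shows "\<exists>W. has_RN_derivative (trace_measure N M) M W"
proof (rule psd_measure_RN_exists[OF _ _ assms])
  have "finite_measure (trace_measure N M)"
    using emeasure_trace_measure[OF assms sets.top] by (intro finite_measureI) simp
  then show "sigma_finite_measure (trace_measure N M)" by (rule finite_measure.axioms(1))
  fix B assume "B \<in> sets (trace_measure N M)" "emeasure (trace_measure N M) B = 0"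
  then have "pos_semidef (M B)" "Re (trace (M B)) \<le> 0"
    using assms emeasure_trace_measure[OF assms, of B] by (auto simp: psd_measure_def ennreal_eq_0_iff)
  then show "M B = 0" using trace_pos_semidef_nonneg[of "M B"] pos_semidef_trace_zero by force
qed simp

text \<open>With \<open>t = tr D\<close> the trace measure is \<open>t dT\<close>, and uniqueness of densities gives \<open>D = t W\<close>. Since the power
  with exponent \<open>1 / \<alpha>\<close> is homogeneous of that degree, the integrand for \<open>D\<close> is \<open>t\<close> times the integrand
  for \<open>W\<close>. As the right-hand side does not mention \<open>T\<close> or \<open>D\<close>, any two dominating measures yield the
  same integral.\<close>

lemma weighted_integral_eq_trace_measure:
  assumes D: "has_RN_derivative T M D" and M: "psd_measure N M" and sets: "sets T = sets N"
    and W: "has_RN_derivative (trace_measure N M) M W"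
    and f: "f \<in> borel_measurable N" and \<alpha>: "0 < \<alpha>"
  shows "(\<integral>x. norm (psd_power (D x) (1 / \<alpha>) *v f x) powr \<alpha> \<partial>T)
       = (\<integral>x. norm (psd_power (W x) (1 / \<alpha>) *v f x) powr \<alpha> \<partial>(trace_measure N M))"
proof -
  define t where "t x = Re (trace (D x))" for x
  note dens = trace_measure_eq_density[OF D M sets, folded t_def]
  have int: "integrable T D" using D by (simp add: has_RN_derivative_def)
  then have [measurable]: "D \<in> borel_measurable T" by simp
  have tm[measurable]: "t \<in> borel_measurable T"
    using integrable_bounded_linear[of "\<lambda>X. Re (trace X)"] linear_Re_trace linear_linear int
    unfolding t_def by (metis borel_measurable_integrable)
  have [measurable]: "f \<in> borel_measurable T" using f measurable_cong_sets[OF sets refl] by blast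
  have Wint: "integrable (density T (\<lambda>x. ennreal (t x))) W" using W by (simp add: has_RN_derivative_def dens)
  then have "W \<in> borel_measurable (density T (\<lambda>x. ennreal (t x)))" by (rule borel_measurable_integrable)
  then have [measurable]: "W \<in> borel_measurable T" by simp
  have [measurable]: "(\<lambda>x. psd_power (W x) (1 / \<alpha>) *v f x) \<in> borel_measurable T"
    "(\<lambda>x. psd_power (D x) (1 / \<alpha>) *v f x) \<in> borel_measurable T"
    using \<alpha> by (simp_all add: measurable_psd_power_vec)
  have psdD: "AE x in T. pos_semidef (D x)" by (rule RN_derivative_AE_psd[OF D M sets])
  then have nn: "AE x in T. 0 \<le> t x" unfolding t_def by eventually_elim (rule trace_pos_semidef_nonneg)
  have psdW: "AE x in T. 0 < t x \<longrightarrow> pos_semidef (W x)"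
    using RN_derivative_AE_psd[OF W M sets_nonneg_measure] unfolding dens by (subst (asm) AE_density) auto
  have DW: "AE x in T. D x = t x *\<^sub>R W x"
  proof (rule AE_eq_of_set_integrals_eq[OF int])
    show "integrable T (\<lambda>x. t x *\<^sub>R W x)"
      using Wint nn by (subst (asm) integrable_density) auto
    fix B assume B[measurable]: "B \<in> sets T"
    have "set_lebesgue_integral T B D = set_lebesgue_integral (density T (\<lambda>x. ennreal (t x))) B W"
      using D W B sets unfolding dens by (simp add: has_RN_derivative_def)
    also have "\<dots> = (\<integral>x. t x *\<^sub>R (indicator B x *\<^sub>R W x) \<partial>T)"
      unfolding set_lebesgue_integral_def using nn by (intro integral_density) auto
    finally show "set_lebesgue_integral T B D = set_lebesgue_integral T B (\<lambda>x. t x *\<^sub>R W x)"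
      by (simp add: set_lebesgue_integral_def mult.commute)
  qed
  have "(\<integral>x. norm (psd_power (W x) (1 / \<alpha>) *v f x) powr \<alpha> \<partial>(trace_measure N M))
     = (\<integral>x. t x *\<^sub>R norm (psd_power (W x) (1 / \<alpha>) *v f x) powr \<alpha> \<partial>T)"
    unfolding dens using nn by (intro integral_density) auto
  also have "\<dots> = (\<integral>x. norm (psd_power (D x) (1 / \<alpha>) *v f x) powr \<alpha> \<partial>T)"
  proof (rule integral_cong_AE)
    show "AE x in T. t x *\<^sub>R norm (psd_power (W x) (1 / \<alpha>) *v f x) powr \<alpha>
        = norm (psd_power (D x) (1 / \<alpha>) *v f x) powr \<alpha>"
      using nn psdW DW
    proof eventually_elim
      case (elim x)
      show ?case
      proof (cases "t x = 0")
        case True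
        then show ?thesis using elim(3) by (simp add: psd_power_zero)
      next
        case False
        then have "psd_power (D x) (1 / \<alpha>) = (t x powr (1 / \<alpha>)) *\<^sub>R psd_power (W x) (1 / \<alpha>)"
          using elim by (subst elim(3)) (simp add: psd_power_scaleR)
        then show ?thesis using \<alpha> elim(1)
          by (simp add: scaleR_matrix_vector powr_mult powr_powr)
      qed
    qed
  qed measurable
  finally show ?thesis by simp
qed

section \<open>The Lebesgue decomposition of a matrix measure\<close>

text \<open>The partition of \<open>B\<close> into \<open>E\<close> and its complement bounds \<open>\<bar>\<mu> E\<bar>\<close> by the variation.\<close>

lemma variation_zero_imp:
  assumes "variation N \<mu> B = 0" "E \<in> sets N" "E \<subseteq> B" "B \<in> sets N" "\<mu> {} = 0"
  shows "\<mu> E = 0"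
proof (cases "E = {}")
  case False
  define P where "P = {E, B - E} - {{}}"
  have P: "P \<in> {P. finite P \<and> P \<subseteq> sets N \<and> partition_on B P}"
    using assms by (auto simp: P_def partition_on_def disjoint_def)
  have "ennreal (norm (\<mu> E)) \<le> (\<Sum>E\<in>P. ennreal (norm (\<mu> E)))"
    using False P by (intro member_le_sum) (auto simp: P_def)
  also have "\<dots> \<le> variation N \<mu> B" unfolding variation_def by (rule SUP_upper[OF P])
  finally show ?thesis by (simp add: assms(1))
qed (simp add: assms(5))

lemma abs_continuousD:
  assumes "abs_continuous T M" "vector_measure T M" "B \<in> sets T" "emeasure T B = 0"
  shows "M B = 0"
proof -
  have "M {} = 0" using assms(2) by (simp add: vector_measure_def)
  then have "M B $ i $ j = 0" for i j
    using assms variation_zero_imp[of T "\<lambda>E. M E $ i $ j" B B] by (simp add: abs_continuous_def)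
  then show ?thesis by (simp add: vec_eq_iff)
qed

text \<open>The singular part lives on some null set \<open>Y\<close>, so \<open>Ma\<close> and \<open>Ms\<close> are the restrictions of \<open>M\<close> to the
  complement of \<open>Y\<close> and to \<open>Y\<close>; in particular both are positive semidefinite. Hence \<open>Ma A = 0\<close>
  and \<open>Ms (space N - A) = 0\<close> are inherited by all measurable subsets, and \<open>A\<close> can take the place of \<open>Y\<close>.\<close>

lemma lebesgue_decomposition_abs_part:
  fixes M Ma Ms :: "'w set \<Rightarrow> complex^'q^'q"
  assumes M: "psd_measure N M" and sets: "sets T = sets N"
    and dec: "lebesgue_decomposition T M Ma Ms"
    and A: "A \<in> sets N" "Ma A = 0" "Ms (space N - A) = 0" and B: "B \<in> sets N"
  shows "Ma B = M (B - A)"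
proof -
  have vma: "vector_measure T Ma" and vms: "vector_measure T Ms"
    and sum: "\<And>B. B \<in> sets T \<Longrightarrow> M B = Ma B + Ms B"
    and ac: "abs_continuous T Ma" and sing: "singular T Ms"
    using dec by (auto simp: lebesgue_decomposition_def)
  have Ms0: "Ms {} = 0" using vms by (simp add: vector_measure_def)
  have "\<exists>Z. \<forall>i j. Z i j \<in> sets T \<and> emeasure T (Z i j) = 0 \<and>
      variation T (\<lambda>E. Ms E $ i $ j) (space T - Z i j) = 0"
    using sing unfolding singular_def by metis
  then obtain Z where Z: "\<And>i j. Z i j \<in> sets T" "\<And>i j. emeasure T (Z i j) = 0"
    "\<And>i j. variation T (\<lambda>E. Ms E $ i $ j) (space T - Z i j) = 0" by blast
  define Y where "Y = (\<Union>i. \<Union>j. Z i j)"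
  have Y: "Y \<in> sets T" unfolding Y_def by (intro sets.finite_UN) (use Z in auto)
  have "Y \<in> null_sets T" unfolding Y_def by (intro null_sets.finite_UN) (use Z in \<open>auto simp: null_sets_def\<close>)
  then have Y0: "emeasure T Y = 0" by auto
  have Ms_off: "Ms (B - Y) = 0" if B: "B \<in> sets T" for B
  proof -
    have "Ms (B - Y) $ i $ j = 0" for i j
      by (rule variation_zero_imp[OF Z(3)[of i j], where E = "B - Y"])
         (use Z(1) B Y Ms0 sets.sets_into_space[OF B] in \<open>auto simp: Y_def\<close>)
    then show ?thesis by (simp add: vec_eq_iff)
  qed
  have Ma_on: "Ma (B \<inter> Y) = 0" if B: "B \<in> sets T" for B
    using emeasure_mono[of "B \<inter> Y" Y T] Y Y0 B by (intro abs_continuousD[OF ac vma]) auto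
  have Ma_eq: "Ma B = M (B - Y)" if "B \<in> sets T" for B
    using vector_measure_split[OF vma that Y] Ma_on[OF that] Ms_off[OF that] sum[of "B - Y"] that Y by simp
  have Ms_eq: "Ms B = M (B \<inter> Y)" if "B \<in> sets T" for B
    using vector_measure_split[OF vms that Y] Ma_on[OF that] Ms_off[OF that] sum[of "B \<inter> Y"] that Y by simp
  have psd: "pos_semidef (Ma C)" "pos_semidef (Ms C)" if "C \<in> sets T" for C
    using M that Y by (auto simp: Ma_eq Ms_eq psd_measure_def sets)
  have T: "A \<in> sets T" "B \<in> sets T" using A B by (simp_all add: sets)
  have "Ma A = Ma (A \<inter> B) + Ma (A - B)" by (rule vector_measure_split[OF vma T])
  then have MaA: "Ma (A \<inter> B) = 0" using A T by (intro pos_semidef_add_zero[OF psd(1) psd(1)]) auto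
  have sp: "space T - A \<in> sets T" "space T = space N" using sets.compl_sets[OF T(1)] sets_eq_imp_space_eq[OF sets] by auto
  have "B \<inter> (space T - A) = B - A" using sets.sets_into_space[OF T(2)] by blast
  then have "Ms (space T - A) = Ms (B - A) + Ms (space T - A - B)"
    using vector_measure_split[OF vms sp(1) T(2)] by (simp add: Int_commute)
  then have "Ms (B - A) = 0"
    using A T sp by (intro pos_semidef_add_zero[OF psd(2) psd(2), of _ "space T - A - B"]) auto
  then have "M (B - A) = Ma (B - A)" using sum[of "B - A"] T by simp
  also have "\<dots> = Ma B" using vector_measure_split[OF vma T(2,1)] MaA by (simp add: Int_commute)
  finally show ?thesis by simp
qed

section \<open>Regular matrix measures and \<open>\<sigma>\<close>-compact sets\<close>

lemma linear_Re_diag: "linear (\<lambda>X :: complex^'q^'q. Re (X $ i $ i))"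
  by (rule linearI) simp_all

text \<open>The diagonal entries are nonnegative, so each finite partition already yields the full measure.\<close>

lemma variation_diag:
  assumes M: "psd_measure N M" and B: "B \<in> sets N"
  shows "variation N (\<lambda>E. M E $ i $ i) B = emeasure (nonneg_measure N (\<lambda>E. Re (M E $ i $ i))) B"
proof -
  define Q where "Q = nonneg_measure N (\<lambda>E. Re (M E $ i $ i))"
  have Q: "ennreal (norm (M E $ i $ i)) = emeasure Q E" if E: "E \<in> sets N" for E
  proof -
    have "pos_semidef (M E)" using M E by (simp add: psd_measure_def)
    from pos_semidef_nth_diag[OF this, of i] have "norm (M E $ i $ i) = Re (M E $ i $ i)"
      by (metis abs_of_nonneg norm_of_real)
    then show ?thesis unfolding Q_def
      using emeasure_nonneg_measure[OF M linear_Re_diag pos_semidef_nth_diag(2) E] by simp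
  qed
  have "(\<Sum>E\<in>P. ennreal (norm (M E $ i $ i))) = emeasure Q B"
    if P: "finite P" "P \<subseteq> sets N" "partition_on B P" for P
  proof -
    have "(\<Sum>E\<in>P. ennreal (norm (M E $ i $ i))) = (\<Sum>E\<in>P. emeasure Q E)"
      using P by (intro sum.cong refl Q) auto
    also have "\<dots> = emeasure Q (\<Union>E\<in>P. E)"
      using P by (intro sum_emeasure) (auto simp: Q_def disjoint_family_on_def partition_on_def disjoint_def)
    finally show ?thesis using P by (simp add: partition_on_def)
  qed
  moreover have "{P. finite P \<and> P \<subseteq> sets N \<and> partition_on B P} \<noteq> {}"
  proof -
    have "{B} - {{}} \<in> {P. finite P \<and> P \<subseteq> sets N \<and> partition_on B P}"
      using B by (cases "B = {}") (auto simp: partition_on_def disjoint_def)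
    then show ?thesis by blast
  qed
  ultimately show ?thesis
    unfolding variation_def Q_def by (intro antisym SUP_least) (auto intro: SUP_upper2)
qed

text \<open>Inner regularity exhausts each diagonal entry by countably many compact sets. Off their union
  the trace of \<open>M\<close> vanishes, and with it \<open>M\<close>.\<close>

lemma regular_psd_measure_sigma_compact:
  fixes M :: "'g::t2_space set \<Rightarrow> complex^'q^'q"
  assumes M: "psd_measure borel M" and reg: "regular_matrix_measure M"
  obtains K :: "nat \<Rightarrow> 'g set" where "\<And>n. compact (K n)"
    "\<And>B. B \<in> sets borel \<Longrightarrow> B \<inter> (\<Union>n. K n) = {} \<Longrightarrow> M B = 0"
proof -
  define Q where "Q i = nonneg_measure borel (\<lambda>E. Re (M E $ i $ i))" for i
  have Qe: "emeasure (Q i) B = ennreal (Re (M B $ i $ i))" if "B \<in> sets borel" for B i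
    unfolding Q_def using emeasure_nonneg_measure[OF M linear_Re_diag pos_semidef_nth_diag(2) that] .
  have comp: "K \<in> sets borel" if "compact K" for K :: "'g set" using that by (simp add: compact_imp_closed)
  have "\<exists>K::nat \<Rightarrow> 'g set. (\<forall>n. compact (K n)) \<and> emeasure (Q i) UNIV = (SUP n. emeasure (Q i) (K n))" for i
  proof -
    let ?v = "variation borel (\<lambda>E. M E $ i $ i)"
    have v: "?v B = emeasure (Q i) B" if "B \<in> sets borel" for B
      unfolding Q_def by (rule variation_diag[OF M that])
    have "regular_set_function ?v" using reg by (simp add: regular_matrix_measure_def)
    then have "?v UNIV = (SUP K\<in>{K. compact K \<and> K \<subseteq> UNIV}. ?v K)"
      unfolding regular_set_function_def by (elim ballE[of _ _ UNIV] conjE) (assumption, simp)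
    also have "\<dots> = (SUP K\<in>{K. compact K}. emeasure (Q i) K)" by (intro SUP_cong) (auto simp: v comp)
    finally have eq: "emeasure (Q i) UNIV = Sup (emeasure (Q i) ` {K. compact K})" by (simp add: v)
    have "emeasure (Q i) ` {K. compact K} \<noteq> {}" using compact_empty by blast
    from ennreal_Sup_countable_SUP[OF this] obtain f :: "nat \<Rightarrow> ennreal"
      where f: "range f \<subseteq> emeasure (Q i) ` {K. compact K}" "Sup (emeasure (Q i) ` {K. compact K}) = (SUP n. f n)" by blast
    have "\<forall>n. \<exists>K. compact K \<and> f n = emeasure (Q i) K" using f(1) by blast
    then obtain K where K: "\<And>n. compact (K n)" "\<And>n. f n = emeasure (Q i) (K n)" by metis
    then show ?thesis using eq f(2) by (intro exI[of _ K]) simp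
  qed
  then have "\<exists>K::'q \<Rightarrow> nat \<Rightarrow> 'g set. \<forall>i. (\<forall>n. compact (K i n)) \<and> emeasure (Q i) UNIV = (SUP n. emeasure (Q i) (K i n))"
    by (intro choice allI)
  then obtain K :: "'q \<Rightarrow> nat \<Rightarrow> 'g set" where K: "\<And>i n. compact (K i n)"
    and sup: "\<And>i. emeasure (Q i) UNIV = (SUP n. emeasure (Q i) (K i n))" by blast
  define K' where "K' n = (\<Union>i. K i n)" for n
  show ?thesis
  proof (rule that[of K'])
    show "compact (K' n)" for n unfolding K'_def by (intro compact_UN K) auto
    fix B assume B: "B \<in> sets borel" "B \<inter> (\<Union>n. K' n) = {}"
    have psd: "pos_semidef (M B)" using M B by (simp add: psd_measure_def)
    have "Re (M B $ i $ i) = 0" for i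
    proof -
      have le: "emeasure (Q i) UNIV \<le> emeasure (Q i) (UNIV - B)"
        unfolding sup
      proof (rule SUP_least)
        fix n show "emeasure (Q i) (K i n) \<le> emeasure (Q i) (UNIV - B)"
          using B by (intro emeasure_mono) (auto simp: Q_def K'_def)
      qed
      have "emeasure (Q i) UNIV = emeasure (Q i) B + emeasure (Q i) (UNIV - B)"
        using B(1) plus_emeasure[of B "Q i" "UNIV - B"] by (simp add: Q_def)
      moreover have "emeasure (Q i) (UNIV - B) \<noteq> \<infinity>" using B(1) by (simp add: Qe)
      ultimately have "emeasure (Q i) B = 0"
        using le by (metis add.commute add_0 ennreal_add_left_cancel_le infinity_ennreal_def le_zero_eq)
      then show ?thesis using pos_semidef_nth_diag(2)[OF psd, of i] Qe[OF B(1), of i] by (simp add: ennreal_eq_0_iff)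
    qed
    then show "M B = 0" by (intro pos_semidef_trace_zero[OF psd]) (simp add: trace_def)
  qed
qed

text \<open>The restriction of \<open>T\<close> to a \<open>\<sigma>\<close>-compact set is \<open>\<sigma>\<close>-finite. This provides derivatives with respect to a
  Haar measure that is not \<open>\<sigma>\<close>-finite.\<close>

lemma RN_exists_of_sigma_compact_support:
  fixes M :: "'g::t2_space set \<Rightarrow> complex^'q^'q"
  assumes M: "psd_measure borel M" and sets: "sets T = sets borel"
    and ac: "\<And>B. B \<in> sets T \<Longrightarrow> emeasure T B = 0 \<Longrightarrow> M B = 0"
    and K: "\<And>n::nat. compact (K n)" "\<And>n. emeasure T (K n) < \<infinity>"
    and supp: "\<And>B. B \<in> sets borel \<Longrightarrow> B \<inter> (\<Union>n. K n) = {} \<Longrightarrow> M B = 0"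
  shows "\<exists>D. has_RN_derivative T M D"
proof -
  have vm: "vector_measure borel M" using M by (simp add: psd_measure_def)
  define C where "C = (\<Union>n. K n)"
  have KT[measurable]: "K n \<in> sets T" for n using K(1) by (simp add: sets compact_imp_closed)
  have C[measurable]: "C \<in> sets T" unfolding C_def by measurable
  define R where "R = density T (\<lambda>x. ennreal (indicator C x))"
  have R: "emeasure R B = emeasure T (C \<inter> B)" if "B \<in> sets T" for B
    using that C by (simp add: R_def ennreal_indicator emeasure_restricted)
  have sets_R: "sets R = sets T" by (simp add: R_def)
  have sp: "space T = UNIV" using sets_eq_imp_space_eq[OF sets] by simp
  have "\<exists>D. has_RN_derivative R M D"
  proof (rule psd_measure_RN_exists[OF _ _ M])
    show "sigma_finite_measure R"
    proof
      show "\<exists>A. countable A \<and> A \<subseteq> Sigma_Algebra.sets R \<and> \<Union> A = space R \<and> (\<forall>a\<in>A. emeasure R a \<noteq> \<infinity>)"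
      \<comment> \<open>The complement of \<open>C\<close> is null for \<open>R\<close>.\<close>
      proof (intro exI[of _ "insert (UNIV - C) (range K)"] conjI ballI)
        show "insert (UNIV - C) (range K) \<subseteq> Sigma_Algebra.sets R"
          using C KT sets.compl_sets[OF C] by (auto simp: sets_R sp)
        show "\<Union> (insert (UNIV - C) (range K)) = space R" by (auto simp: R_def sp C_def)
        fix a assume "a \<in> insert (UNIV - C) (range K)"
        then show "emeasure R a \<noteq> \<infinity>"
        proof
          assume "a = UNIV - C"
          then show ?thesis using sets.compl_sets[OF C] by (simp add: R sp)
        next
          assume "a \<in> range K"
          then obtain n where n: "a = K n" by blast
          then have "C \<inter> a = K n" by (auto simp: C_def)
          then show ?thesis using K(2)[of n] by (simp add: R n)
        qed
      qed simp
    qed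
    show "Sigma_Algebra.sets R = Sigma_Algebra.sets borel" by (simp add: sets_R sets)
    fix B assume "B \<in> Sigma_Algebra.sets R" "emeasure R B = 0"
    then have B: "B \<in> Sigma_Algebra.sets T" and 0: "emeasure T (C \<inter> B) = 0" by (simp_all add: sets_R R)
    have "M (B \<inter> C) = 0" using 0 B C by (intro ac) (auto simp: Int_commute)
    moreover have "M (B - C) = 0" using B C by (intro supp) (auto simp: sets C_def)
    ultimately show "M B = 0" using vector_measure_split[OF vm, of B C] B C by (simp add: sets)
  qed
  then obtain D where D: "integrable R D" "\<And>B. B \<in> sets T \<Longrightarrow> M B = set_lebesgue_integral R B D"
    by (auto simp: has_RN_derivative_def sets_R)
  have [measurable]: "D \<in> borel_measurable T"
    using borel_measurable_integrable[OF D(1)] measurable_cong_sets[OF sets_R refl] by blast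
  have "integrable T (\<lambda>x. indicator C x *\<^sub>R D x)"
    using D(1) unfolding R_def by (subst (asm) integrable_density) auto
  moreover have "M B = set_lebesgue_integral T B (\<lambda>x. indicator C x *\<^sub>R D x)" if B[measurable]: "B \<in> sets T" for B
  proof -
    have "M B = (\<integral>x. indicator C x *\<^sub>R (indicator B x *\<^sub>R D x) \<partial>T)"
      unfolding D(2)[OF B] set_lebesgue_integral_def R_def by (intro integral_density) auto
    then show ?thesis by (simp add: set_lebesgue_integral_def mult.commute)
  qed
  ultimately show ?thesis unfolding has_RN_derivative_def by blast
qed

section \<open>Minkowski's inequality\<close>

text \<open>Convexity of \<open>x powr p\<close> including the endpoint \<open>0\<close>, where it reduces to \<open>s powr p \<le> s\<close> for \<open>s < 1\<close>.\<close>

lemma powr_convex_combination: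
  fixes p :: real
  assumes p: "1 \<le> p" and s: "0 < s" "s < 1" and xy: "0 \<le> x" "0 \<le> y"
  shows "(s * x + (1 - s) * y) powr p \<le> s * x powr p + (1 - s) * y powr p"
proof -
  have edge: "(r * z) powr p \<le> r * z powr p" if "0 < r" "r < 1" "0 \<le> z" for r z
  proof -
    have "r powr p \<le> r powr 1" using that p by (intro powr_mono') auto
    then show ?thesis using that by (simp add: powr_mult mult_right_mono)
  qed
  consider "x = 0" | "y = 0" | "0 < x" "0 < y" using xy by fastforce
  then show ?thesis
  proof cases
    case 1
    then show ?thesis using edge[of "1 - s" y] s xy by simp
  next
    case 2
    then show ?thesis using edge[of s x] s xy by simp
  next
    case 3
    then show ?thesis
      using convex_onD[OF powr_convex[OF p], of "1 - s" x y] s by simp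
  qed
qed

text \<open>Convexity with the weights \<open>a / (a + b)\<close> and \<open>b / (a + b)\<close>, applied to \<open>u / a\<close> and \<open>v / b\<close>. The choice
  \<open>a = b = 1\<close> gives integrability of sums, and taking \<open>a\<close>, \<open>b\<close> to be the norms gives the triangle inequality.\<close>

lemma powr_add_le_weighted:
  fixes p :: real
  assumes p: "1 \<le> p" and ab: "0 < a" "0 < b" and uv: "0 \<le> u" "0 \<le> v"
  shows "(u + v) powr p \<le> (a + b) powr (p - 1) * (a powr (1 - p) * u powr p + b powr (1 - p) * v powr p)"
proof -
  define s where "s = a / (a + b)"
  have s: "0 < s" "s < 1" "1 - s = b / (a + b)" using ab by (auto simp: s_def field_simps)
  have "(u + v) powr p = ((a + b) * (s * (u / a) + (1 - s) * (v / b))) powr p"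
  proof -
    have "s * (u / a) + (1 - s) * (v / b) = (u + v) / (a + b)"
      unfolding s(3) unfolding s_def using ab by (simp add: add_divide_distrib)
    then show ?thesis using ab by simp
  qed
  also have "\<dots> = (a + b) powr p * (s * (u / a) + (1 - s) * (v / b)) powr p"
    by (rule powr_mult)
  also have "\<dots> \<le> (a + b) powr p * (s * (u / a) powr p + (1 - s) * (v / b) powr p)"
    using ab uv by (intro mult_left_mono powr_convex_combination p s) auto
  also have "\<dots> = (a + b) powr (p - 1) * (a powr (1 - p) * u powr p + b powr (1 - p) * v powr p)"
  proof -
    have "d powr p * (c / d * (z / c) powr p) = d powr (p - 1) * (c powr (1 - p) * z powr p)"
      if "0 < c" "0 < d" for c d z :: real
      using that by (simp add: powr_diff powr_divide)
    then show ?thesis unfolding s(3) unfolding s_def using ab by (simp add: distrib_left)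
  qed
  finally show ?thesis .
qed

theorem Minkowski_inequality:
  fixes u v w :: "'w \<Rightarrow> real"
  assumes p: "1 \<le> p" and w: "w \<in> borel_measurable T"
    and u: "integrable T (\<lambda>x. u x powr p)" "\<And>x. 0 \<le> u x"
    and v: "integrable T (\<lambda>x. v x powr p)" "\<And>x. 0 \<le> v x"
    and le: "\<And>x. 0 \<le> w x" "\<And>x. w x \<le> u x + v x"
  shows "integrable T (\<lambda>x. w x powr p)"
    and "(\<integral>x. w x powr p \<partial>T) powr (1 / p)
      \<le> (\<integral>x. u x powr p \<partial>T) powr (1 / p) + (\<integral>x. v x powr p \<partial>T) powr (1 / p)"
proof -
  have [measurable]: "w \<in> borel_measurable T" by (rule w)
  have wle: "w x powr p \<le> (a + b) powr (p - 1) * (a powr (1 - p) * u x powr p + b powr (1 - p) * v x powr p)"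
    if "0 < a" "0 < b" for a b x
  proof -
    have "w x powr p \<le> (u x + v x) powr p" using le p by (intro powr_mono2) auto
    also have "\<dots> \<le> (a + b) powr (p - 1) * (a powr (1 - p) * u x powr p + b powr (1 - p) * v x powr p)"
      by (rule powr_add_le_weighted[OF p that u(2) v(2)])
    finally show ?thesis .
  qed
  have int: "integrable T (\<lambda>x. (a + b) powr (p - 1) * (a powr (1 - p) * u x powr p + b powr (1 - p) * v x powr p))"
    for a b using u(1) v(1) by simp
  show wint: "integrable T (\<lambda>x. w x powr p)"
    using wle[of 1 1] by (intro Bochner_Integration.integrable_bound[OF int[of 1 1]]) (auto intro!: AE_I2 order_trans[OF _ abs_ge_self])
  define U V where "U = (\<integral>x. u x powr p \<partial>T)" and "V = (\<integral>x. v x powr p \<partial>T)"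
  have UV: "0 \<le> U" "0 \<le> V" by (simp_all add: U_def V_def)
  show "(\<integral>x. w x powr p \<partial>T) powr (1 / p) \<le> U powr (1 / p) + V powr (1 / p)"
  proof (rule field_le_epsilon)
    fix e :: real assume "0 < e"
    \<comment> \<open>Adding \<open>e / 2\<close> keeps the weights positive if a norm vanishes.\<close>
    define a b where "a = U powr (1 / p) + e / 2" and "b = V powr (1 / p) + e / 2"
    have ab: "0 < a" "0 < b" using \<open>0 < e\<close> by (auto simp: a_def b_def intro!: add_nonneg_pos)
    have Ua: "U \<le> a powr p"
    proof -
      have "U = (U powr (1 / p)) powr p" using UV p by (simp add: powr_powr)
      also have "\<dots> \<le> a powr p" using p \<open>0 < e\<close> by (intro powr_mono2) (auto simp: a_def)
      finally show ?thesis .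
    qed
    have Vb: "V \<le> b powr p"
    proof -
      have "V = (V powr (1 / p)) powr p" using UV p by (simp add: powr_powr)
      also have "\<dots> \<le> b powr p" using p \<open>0 < e\<close> by (intro powr_mono2) (auto simp: b_def)
      finally show ?thesis .
    qed
    have "(\<integral>x. w x powr p \<partial>T)
        \<le> (\<integral>x. (a + b) powr (p - 1) * (a powr (1 - p) * u x powr p + b powr (1 - p) * v x powr p) \<partial>T)"
      by (intro integral_mono wint int wle ab)
    also have "\<dots> = (a + b) powr (p - 1) * (a powr (1 - p) * U + b powr (1 - p) * V)"
      using u(1) v(1) by (simp add: U_def V_def)
    also have "\<dots> \<le> (a + b) powr (p - 1) * (a powr (1 - p) * a powr p + b powr (1 - p) * b powr p)"
      using Ua Vb by (intro mult_left_mono add_mono) auto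
    also have "\<dots> = (a + b) powr p" using ab by (simp add: powr_diff flip: powr_add)
    finally have "(\<integral>x. w x powr p \<partial>T) powr (1 / p) \<le> ((a + b) powr p) powr (1 / p)"
      using p by (intro powr_mono2) auto
    also have "\<dots> = a + b" using ab p by (simp add: powr_powr)
    finally show "(\<integral>x. w x powr p \<partial>T) powr (1 / p) \<le> U powr (1 / p) + V powr (1 / p) + e"
      by (simp add: a_def b_def)
  qed
qed

section \<open>The metric space \<open>L\<^sup>\<alpha>(M)\<close>\<close>

text \<open>The seminorm, the equivalence relation and the distance of \<open>L\<^sup>\<alpha>(M)\<close> depend on a function \<open>f\<close> only
  through \<open>(dM/dT)\<^sup>1\<^sup>/\<^sup>\<alpha> f\<close>, so that they can be treated as those of an ordinary space of
  vector-valued functions.\<close>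

locale L_alpha =
  fixes T :: "'w measure" and \<alpha> :: real and M :: "'w set \<Rightarrow> complex^'q^'q"
  assumes alpha: "1 < \<alpha>" and psd: "psd_measure T M"
    and RN: "has_RN_derivative T M (RN_derivative T M)"
begin

definition weight :: "'w \<Rightarrow> complex^'q^'q"
  where "weight x = psd_power (RN_derivative T M x) (1 / \<alpha>)"

lemma L_norm_weight: "L_norm T \<alpha> M f = (\<integral>x. norm (weight x *v f x) powr \<alpha> \<partial>T) powr (1 / \<alpha>)"
  by (simp add: L_norm_def weight_def)

lemma L_functions_weight:
  "f \<in> L_functions T \<alpha> M \<longleftrightarrow> f \<in> borel_measurable T \<and> integrable T (\<lambda>x. norm (weight x *v f x) powr \<alpha>)"
  by (simp add: L_functions_def weight_def)

lemma AE_psd: "AE x in T. pos_semidef (RN_derivative T M x)"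
  by (rule RN_derivative_AE_psd[OF RN psd refl])

lemma measurable_weight [measurable (raw)]:
  "f \<in> borel_measurable T \<Longrightarrow> (\<lambda>x. weight x *v f x) \<in> borel_measurable T"
  unfolding weight_def using RN alpha
  by (intro measurable_psd_power_vec) (auto simp: has_RN_derivative_def)

text \<open>Almost everywhere, the range projection and the weight have the same kernel.\<close>

lemma M_equivalent_weight: "M_equivalent T M f g \<longleftrightarrow> (AE x in T. weight x *v f x = weight x *v g x)"
proof -
  have "AE x in T. range_projection (RN_derivative T M x) *v f x = range_projection (RN_derivative T M x) *v g x
      \<longleftrightarrow> weight x *v f x = weight x *v g x"
    using AE_psd
  proof eventually_elim
    case (elim x)
    show ?case
      using range_projection_vec_zero_iff[OF elim, of "f x - g x"] psd_power_vec_zero_iff[OF elim, of "1 / \<alpha>" "f x - g x"]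
      by (simp add: weight_def matrix_vector_mult_diff_distrib)
  qed
  then show ?thesis unfolding M_equivalent_def by (rule eventually_subst)
qed

lemma L_class_weight:
  "g \<in> L_class T M f \<longleftrightarrow> g \<in> borel_measurable T \<and> (AE x in T. weight x *v f x = weight x *v g x)"
  by (simp add: L_class_def M_equivalent_weight)

lemma L_class_eq_iff:
  assumes "f \<in> borel_measurable T" "g \<in> borel_measurable T"
  shows "L_class T M f = L_class T M g \<longleftrightarrow> (AE x in T. weight x *v f x = weight x *v g x)"
proof
  assume "L_class T M f = L_class T M g"
  moreover have "g \<in> L_class T M g" using assms by (simp add: L_class_weight)
  ultimately have "g \<in> L_class T M f" by simp
  then show "AE x in T. weight x *v f x = weight x *v g x" by (simp add: L_class_weight)
next
  assume eq: "AE x in T. weight x *v f x = weight x *v g x"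
  have "(AE x in T. weight x *v f x = weight x *v h x) \<longleftrightarrow> (AE x in T. weight x *v g x = weight x *v h x)" for h
    by (rule eventually_subst) (use eq in \<open>auto elim: eventually_mono\<close>)
  then show "L_class T M f = L_class T M g" by (simp add: set_eq_iff L_class_weight)
qed

lemma L_functions_diff:
  assumes f: "f \<in> L_functions T \<alpha> M" and g: "g \<in> L_functions T \<alpha> M"
  shows "(\<lambda>x. f x - g x) \<in> L_functions T \<alpha> M"
    and L_norm_diff_le: "L_norm T \<alpha> M (\<lambda>x. f x - g x) \<le> L_norm T \<alpha> M f + L_norm T \<alpha> M g"
proof -
  have [measurable]: "f \<in> borel_measurable T" "g \<in> borel_measurable T"
    using f g by (auto simp: L_functions_weight)
  have "norm (weight x *v (f x - g x)) \<le> norm (weight x *v f x) + norm (weight x *v g x)" for x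
    by (simp add: matrix_vector_mult_diff_distrib norm_triangle_ineq4)
  note mink = Minkowski_inequality[OF _ _ _ norm_ge_zero _ norm_ge_zero norm_ge_zero this, where p = \<alpha> and T = T]
  show "(\<lambda>x. f x - g x) \<in> L_functions T \<alpha> M"
    using mink(1) f g alpha by (simp add: L_functions_weight)
  show "L_norm T \<alpha> M (\<lambda>x. f x - g x) \<le> L_norm T \<alpha> M f + L_norm T \<alpha> M g"
    using mink(2) f g alpha by (simp add: L_functions_weight L_norm_weight)
qed

lemma L_norm_cong:
  assumes "AE x in T. weight x *v f x = weight x *v g x" "f \<in> borel_measurable T" "g \<in> borel_measurable T"
  shows "L_norm T \<alpha> M f = L_norm T \<alpha> M g"
proof -
  note [measurable] = assms(2,3)
  have "(\<integral>x. norm (weight x *v f x) powr \<alpha> \<partial>T) = (\<integral>x. norm (weight x *v g x) powr \<alpha> \<partial>T)"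
    using assms(1) by (intro integral_cong_AE) (auto elim: eventually_mono)
  then show ?thesis by (simp add: L_norm_weight)
qed

lemma L_norm_zero_iff:
  assumes "f \<in> L_functions T \<alpha> M"
  shows "L_norm T \<alpha> M f = 0 \<longleftrightarrow> (AE x in T. weight x *v f x = 0)"
proof -
  have "L_norm T \<alpha> M f = 0 \<longleftrightarrow> (\<integral>x. norm (weight x *v f x) powr \<alpha> \<partial>T) = 0" by (simp add: L_norm_weight)
  also have "\<dots> \<longleftrightarrow> (AE x in T. norm (weight x *v f x) powr \<alpha> = 0)"
    using assms by (intro integral_nonneg_eq_0_iff_AE) (auto simp: L_functions_weight)
  finally show ?thesis by simp
qed

text \<open>The distance is defined through arbitrary representatives; equivalent representatives have the same
  weighted versions.\<close>

lemma L_dist_class: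
  assumes f: "f \<in> borel_measurable T" and g: "g \<in> borel_measurable T"
  shows "L_dist T \<alpha> M (L_class T M f) (L_class T M g) = L_norm T \<alpha> M (\<lambda>x. f x - g x)"
proof -
  have self: "h \<in> L_class T M h" if "h \<in> borel_measurable T" for h
    using that by (simp add: L_class_weight)
  have F: "(SOME h. h \<in> L_class T M f) \<in> L_class T M f" (is "?f \<in> _")
    by (rule someI[where P = "\<lambda>h. h \<in> L_class T M f", OF self[OF f]])
  have G: "(SOME h. h \<in> L_class T M g) \<in> L_class T M g" (is "?g \<in> _")
    by (rule someI[where P = "\<lambda>h. h \<in> L_class T M g", OF self[OF g]])
  have "AE x in T. weight x *v (?f x - ?g x) = weight x *v (f x - g x)"
    using F G by (auto simp: L_class_weight matrix_vector_mult_diff_distrib)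
  then show ?thesis
    unfolding L_dist_def using F G f g by (intro L_norm_cong) (auto simp: L_class_weight)
qed

text \<open>Required before the closure can be described by approximation, since the closure operator refers to the
  topology of a metric space.\<close>

lemma Metric_space_L: "Metric_space (L_space T \<alpha> M) (L_dist T \<alpha> M)"
proof
  show "0 \<le> L_dist T \<alpha> M F G" for F G by (simp add: L_dist_def L_norm_weight)
  show "L_dist T \<alpha> M F G = L_dist T \<alpha> M G F" for F G
    by (simp add: L_dist_def L_norm_weight matrix_vector_mult_diff_distrib norm_minus_commute)
next
  fix F G assume "F \<in> L_space T \<alpha> M" "G \<in> L_space T \<alpha> M"
  then obtain f g where f: "f \<in> L_functions T \<alpha> M" "F = L_class T M f"
    and g: "g \<in> L_functions T \<alpha> M" "G = L_class T M g" by (auto simp: L_space_def)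
  have m: "f \<in> borel_measurable T" "g \<in> borel_measurable T" using f g by (auto simp: L_functions_weight)
  show "(L_dist T \<alpha> M F G = 0) = (F = G)"
    unfolding f g L_dist_class[OF m] L_class_eq_iff[OF m] L_norm_zero_iff[OF L_functions_diff(1)[OF f(1) g(1)]]
    by (simp add: matrix_vector_mult_diff_distrib)
next
  fix F G H assume "F \<in> L_space T \<alpha> M" "G \<in> L_space T \<alpha> M" "H \<in> L_space T \<alpha> M"
  then obtain f g h where f: "f \<in> L_functions T \<alpha> M" "F = L_class T M f"
    and g: "g \<in> L_functions T \<alpha> M" "G = L_class T M g"
    and h: "h \<in> L_functions T \<alpha> M" "H = L_class T M h" by (auto simp: L_space_def)
  have m: "f \<in> borel_measurable T" "g \<in> borel_measurable T" "h \<in> borel_measurable T"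
    using f g h by (auto simp: L_functions_weight)
  have "L_norm T \<alpha> M (\<lambda>x. (f x - g x) - (h x - g x)) \<le> L_norm T \<alpha> M (\<lambda>x. f x - g x) + L_norm T \<alpha> M (\<lambda>x. h x - g x)"
    by (intro L_norm_diff_le L_functions_diff f g h)
  moreover have "L_norm T \<alpha> M (\<lambda>x. h x - g x) = L_norm T \<alpha> M (\<lambda>x. g x - h x)"
    by (simp add: L_norm_weight matrix_vector_mult_diff_distrib norm_minus_commute)
  ultimately show "L_dist T \<alpha> M F H \<le> L_dist T \<alpha> M F G + L_dist T \<alpha> M G H"
    unfolding f g h by (simp add: L_dist_class m)
qed

lemma L_closure_approx:
  assumes X: "X \<subseteq> L_functions T \<alpha> M" and f: "f \<in> borel_measurable T"
    and cl: "L_class T M f \<in> L_closure T \<alpha> M (L_class T M ` X)" and e: "0 < e"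
  shows "\<exists>t\<in>X. L_norm T \<alpha> M (\<lambda>x. f x - t x) < e"
proof -
  interpret Metric_space "L_space T \<alpha> M" "L_dist T \<alpha> M" by (rule Metric_space_L)
  obtain t where t: "t \<in> X" "L_dist T \<alpha> M (L_class T M f) (L_class T M t) < e"
    using cl e unfolding L_closure_def metric_closure_of by auto
  then show ?thesis using X f by (intro bexI[OF _ t(1)]) (auto simp: L_dist_class L_functions_weight)
qed

lemma bounded_in_L_functions:
  assumes f: "f \<in> borel_measurable T" and C: "\<And>x. norm (f x) \<le> C"
  shows "f \<in> L_functions T \<alpha> M"
proof -
  note [measurable] = f
  have C0: "0 \<le> C" using C norm_ge_zero order_trans by blast
  have "integrable T (\<lambda>x. Re (trace (RN_derivative T M x)))"
    using RN integrable_bounded_linear[OF linear_Re_trace[unfolded linear_conv_bounded_linear]]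
    by (auto simp: has_RN_derivative_def)
  then have int: "integrable T (\<lambda>x. Re (trace (RN_derivative T M x)) * C powr \<alpha>)" by simp
  have "integrable T (\<lambda>x. norm (weight x *v f x) powr \<alpha>)"
  proof (rule Bochner_Integration.integrable_bound[OF int])
    show "AE x in T. norm (norm (weight x *v f x) powr \<alpha>) \<le> norm (Re (trace (RN_derivative T M x)) * C powr \<alpha>)"
      using AE_psd
    proof eventually_elim
      case (elim x)
      let ?t = "Re (trace (RN_derivative T M x))"
      have t0: "0 \<le> ?t" by (rule trace_pos_semidef_nonneg[OF elim])
      have "norm (weight x *v f x) \<le> ?t powr (1 / \<alpha>) * norm (f x)"
        unfolding weight_def using alpha by (intro norm_psd_power_vec_le elim) auto
      also have "\<dots> \<le> ?t powr (1 / \<alpha>) * C" by (intro mult_left_mono C) auto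
      finally have "norm (weight x *v f x) powr \<alpha> \<le> (?t powr (1 / \<alpha>) * C) powr \<alpha>"
        using alpha by (intro powr_mono2) auto
      also have "\<dots> = ?t * C powr \<alpha>" using t0 C0 alpha by (simp add: powr_mult powr_powr)
      finally show ?case using t0 by simp
    qed
  qed measurable
  then show ?thesis using f by (simp add: L_functions_weight)
qed

end

section \<open>Trigonometric polynomials\<close>

text \<open>Singletons are compact, so evaluation at \<open>x\<close> is continuous for uniform convergence on compact sets.\<close>

lemma continuous_on_chi: "continuous_on UNIV (chi x)"
  unfolding continuous_on_topological
proof (intro ballI allI impI)
  fix \<gamma> :: "'a dual_group" and W assume W: "open W" "chi x \<gamma> \<in> W"
  then obtain e where e: "0 < e" "ball (chi x \<gamma>) e \<subseteq> W" using open_contains_ball by blast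
  have "open (dual_nbhd \<gamma> {x} e)" "\<gamma> \<in> dual_nbhd \<gamma> {x} e"
    using e by (auto intro: open_dual_nbhd mem_dual_nbhd)
  moreover have "chi x \<delta> \<in> W" if "\<delta> \<in> dual_nbhd \<gamma> {x} e" for \<delta>
    using that e(2) by (auto simp: dual_nbhd_def chi_def dist_norm norm_minus_commute)
  ultimately show "\<exists>A. open A \<and> \<gamma> \<in> A \<and> (\<forall>y\<in>UNIV. y \<in> A \<longrightarrow> chi x y \<in> W)" by blast
qed

lemma continuous_on_trig_poly: "continuous_on UNIV (\<lambda>\<gamma>. \<Sum>j<n. chi (x j) \<gamma> *s u j)"
  unfolding vector_scalar_mult_def
  by (intro continuous_intros continuous_on_subset[OF continuous_on_chi]) auto

lemma norm_chi_smult: "norm (chi x \<gamma> *s u) = norm u"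
  by (simp add: norm_vec_def chi_def norm_mult pairing_norm)

lemma trig_poly_measurable_bounded:
  assumes "t \<in> trig_polys X"
  shows "t \<in> borel_measurable borel" "\<exists>C. \<forall>\<gamma>. norm (t \<gamma>) \<le> C"
proof -
  obtain n :: nat and x u where t: "t = (\<lambda>\<gamma>. \<Sum>j<n. chi (x j) \<gamma> *s u j)"
    using assms by (auto simp: trig_polys_def)
  show "t \<in> borel_measurable borel"
    unfolding t by (intro borel_measurable_continuous_onI continuous_on_trig_poly)
  have "norm (t \<gamma>) \<le> (\<Sum>j<n. norm (u j))" for \<gamma>
    unfolding t by (rule order_trans[OF norm_sum]) (simp add: norm_chi_smult)
  then show "\<exists>C. \<forall>\<gamma>. norm (t \<gamma>) \<le> C" by blast
qed

lemma zero_in_trig_polys: "(\<lambda>_. 0) \<in> trig_polys X"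
  unfolding trig_polys_def by (auto intro!: exI[of _ 0])

lemma sum_lessThan_add: "(\<Sum>j<n + m. f j) = (\<Sum>j<n. f j) + (\<Sum>j<m. f (n + j))" for f :: "nat \<Rightarrow> 'b::comm_monoid_add"
  by (induction m) (auto simp: add.assoc)

lemma trig_polys_add:
  assumes "s \<in> trig_polys X" "t \<in> trig_polys X"
  shows "(\<lambda>\<gamma>. s \<gamma> + t \<gamma>) \<in> trig_polys X"
proof -
  obtain n :: nat and x u where s: "s = (\<lambda>\<gamma>. \<Sum>j<n. chi (x j) \<gamma> *s u j)" "\<forall>j<n. x j \<in> X"
    using assms(1) by (auto simp: trig_polys_def)
  obtain m :: nat and y v where t: "t = (\<lambda>\<gamma>. \<Sum>j<m. chi (y j) \<gamma> *s v j)" "\<forall>j<m. y j \<in> X"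
    using assms(2) by (auto simp: trig_polys_def)
  define z w where "z j = (if j < n then x j else y (j - n))" and "w j = (if j < n then u j else v (j - n))" for j
  have "(\<lambda>\<gamma>. s \<gamma> + t \<gamma>) = (\<lambda>\<gamma>. \<Sum>j<n + m. chi (z j) \<gamma> *s w j)"
    by (simp add: s t sum_lessThan_add z_def w_def)
  moreover have "\<forall>j<n + m. z j \<in> X" using s(2) t(2) by (auto simp: z_def)
  ultimately show ?thesis unfolding trig_polys_def by blast
qed

lemma monomial_in_trig_polys: "(\<lambda>\<gamma>. chi s \<gamma> *s u) \<in> trig_polys UNIV"
  unfolding trig_polys_def by (auto intro!: exI[of _ "1::nat"] exI[of _ "\<lambda>_. s"] exI[of _ "\<lambda>_. u"])

section \<open>Approximation over the absolutely continuous part\<close>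

lemma psd_measure_diff_set:
  assumes M: "psd_measure N M" and A: "A \<in> sets N"
  shows "psd_measure N (\<lambda>B. M (B - A))"
  unfolding psd_measure_def vector_measure_def
proof (intro conjI allI impI ballI)
  show "M ({} - A) = 0" using M by (simp add: psd_measure_def vector_measure_def)
next
  fix B :: "nat \<Rightarrow> 'a set" assume B: "range B \<subseteq> sets N" "disjoint_family B"
  have "range (\<lambda>i. B i - A) \<subseteq> sets N" "disjoint_family (\<lambda>i. B i - A)"
    using B A by (auto simp: disjoint_family_on_def)
  then have "(\<lambda>i. M (B i - A)) sums M (\<Union>i. B i - A)"
    using M unfolding psd_measure_def vector_measure_def by blast
  then show "(\<lambda>i. M (B i - A)) sums M ((\<Union>i. B i) - A)" by simp
qed (use M A in \<open>auto simp: psd_measure_def\<close>)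

text \<open>The derivative of \<open>Ma\<close> with respect to \<open>\<tau>\<close> is that of \<open>M\<close> times
  the indicator of the complement of \<open>A\<close>. Passing from \<open>\<nu>\<close> to \<open>\<tau>\<close>
  through the trace measure of \<open>Ma\<close> and moving the indicator to the function identifies the two integrals.\<close>

lemma weighted_integral_abs_part:
  fixes M Ma :: "'w set \<Rightarrow> complex^'q^'q"
  assumes M: "psd_measure N M" and sets: "sets \<nu> = sets N" "sets \<tau> = sets N"
    and D: "has_RN_derivative \<nu> Ma D" and E: "has_RN_derivative \<tau> M E"
    and Ma: "\<And>B. B \<in> sets N \<Longrightarrow> Ma B = M (B - A)" and A: "A \<in> sets N"
    and f: "f \<in> borel_measurable N" and \<alpha>: "0 < \<alpha>"
  shows "(\<integral>x. norm (psd_power (D x) (1 / \<alpha>) *v f x) powr \<alpha> \<partial>\<nu>)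
       = (\<integral>x. norm (psd_power (E x) (1 / \<alpha>) *v (indicator (space N - A) x *\<^sub>R f x)) powr \<alpha> \<partial>\<tau>)"
proof -
  define N' where "N' = (\<lambda>B. M (B - A))"
  define c :: "'w \<Rightarrow> real" where "c = indicator (space N - A)"
  have psd': "psd_measure N N'" unfolding N'_def by (rule psd_measure_diff_set[OF M A])
  have D': "has_RN_derivative \<nu> N' D"
    using D by (auto simp: has_RN_derivative_def N'_def sets simp flip: Ma)
  have int: "integrable \<tau> E" and ME: "\<And>B. B \<in> sets N \<Longrightarrow> M B = set_lebesgue_integral \<tau> B E"
    using E by (auto simp: has_RN_derivative_def sets)
  have Ac: "space N - A \<in> Sigma_Algebra.sets \<tau>" using A by (auto simp: sets)
  have E': "has_RN_derivative \<tau> N' (\<lambda>x. c x *\<^sub>R E x)"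
    unfolding has_RN_derivative_def
  proof (intro conjI ballI)
    show "integrable \<tau> (\<lambda>x. c x *\<^sub>R E x)" unfolding c_def by (rule integrable_mult_indicator[OF Ac int])
    fix B assume "B \<in> Sigma_Algebra.sets \<tau>"
    then have B: "B \<in> Sigma_Algebra.sets N" by (simp add: sets)
    have "N' B = set_lebesgue_integral \<tau> (B - A) E" using B A by (simp add: N'_def ME)
    also have "\<dots> = set_lebesgue_integral \<tau> B (\<lambda>x. c x *\<^sub>R E x)"
      unfolding set_lebesgue_integral_def
      by (intro Bochner_Integration.integral_cong refl)
         (use sets.sets_into_space[OF B] in \<open>auto simp: c_def indicator_def\<close>)
    finally show "N' B = set_lebesgue_integral \<tau> B (\<lambda>x. c x *\<^sub>R E x)" .
  qed
  obtain W where W: "has_RN_derivative (trace_measure N N') N' W" using trace_measure_RN_exists[OF psd'] by blast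
  have [measurable]: "f \<in> borel_measurable \<tau>" "E \<in> borel_measurable \<tau>" "c \<in> borel_measurable \<tau>"
    using f int measurable_cong_sets[OF sets(2) refl] Ac by (auto simp: c_def)
  have "(\<integral>x. norm (psd_power (D x) (1 / \<alpha>) *v f x) powr \<alpha> \<partial>\<nu>)
      = (\<integral>x. norm (psd_power (c x *\<^sub>R E x) (1 / \<alpha>) *v f x) powr \<alpha> \<partial>\<tau>)"
    using weighted_integral_eq_trace_measure[OF D' psd' sets(1) W f \<alpha>]
      weighted_integral_eq_trace_measure[OF E' psd' sets(2) W f \<alpha>] by simp
  also have "\<dots> = (\<integral>x. norm (psd_power (E x) (1 / \<alpha>) *v (c x *\<^sub>R f x)) powr \<alpha> \<partial>\<tau>)"
  proof (rule integral_cong_AE)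
    show "AE x in \<tau>. norm (psd_power (c x *\<^sub>R E x) (1 / \<alpha>) *v f x) powr \<alpha>
        = norm (psd_power (E x) (1 / \<alpha>) *v (c x *\<^sub>R f x)) powr \<alpha>"
      by (rule AE_I2) (simp add: c_def indicator_def psd_power_zero)
    have "(\<lambda>x. psd_power (c x *\<^sub>R E x) (1 / \<alpha>) *v f x) \<in> borel_measurable \<tau>"
      "(\<lambda>x. psd_power (E x) (1 / \<alpha>) *v (c x *\<^sub>R f x)) \<in> borel_measurable \<tau>"
      using \<alpha> by (auto intro!: measurable_psd_power_vec)
    then show "(\<lambda>x. norm (psd_power (c x *\<^sub>R E x) (1 / \<alpha>) *v f x) powr \<alpha>) \<in> borel_measurable \<tau>"
      "(\<lambda>x. norm (psd_power (E x) (1 / \<alpha>) *v (c x *\<^sub>R f x)) powr \<alpha>) \<in> borel_measurable \<tau>"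
      by measurable
  qed
  finally show ?thesis by (simp add: c_def)
qed

theorem theorem4p1:
  fixes S :: "'a::{topological_ab_group_add,t2_space} set"
    and \<nu> \<tau> :: "'a dual_group measure"
    and M Ma Ms :: "'a dual_group set \<Rightarrow> complex^'q^'q"
    and \<alpha> :: real
    and A :: "'a dual_group set"
  assumes "1 < \<alpha>"
    and "locally_compact_space (euclidean :: 'a topology)"
    and "haar_measure \<nu>"
    and "S \<noteq> {}"
    and "psd_measure borel M" and "regular_matrix_measure M"
    and "lebesgue_decomposition \<nu> M Ma Ms"
    and "sigma_finite_measure \<tau>" and "sets \<tau> = sets borel" and "abs_continuous \<tau> M"
    and "A \<in> sets borel" and "Ma A = 0" and "Ms (UNIV - A) = 0"
    and "L_singular_space \<tau> \<alpha> M A \<subseteq> L_closure \<tau> \<alpha> M (L_class \<tau> M ` trig_polys (UNIV - S))"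
  shows "\<forall>s\<in>S. \<forall>k::'q.
    (INF t\<in>trig_polys (UNIV - S). L_norm \<tau> \<alpha> M (\<lambda>\<gamma>. chi s \<gamma> *s axis k 1 - t \<gamma>)) =
    (INF t\<in>trig_polys (UNIV - S).
       (\<integral>\<gamma>. norm (psd_power (RN_derivative \<nu> Ma \<gamma>) (1 / \<alpha>) *v
                    (chi s \<gamma> *s axis k 1 - t \<gamma>)) powr \<alpha> \<partial>\<nu>) powr (1 / \<alpha>))"
proof (intro ballI allI)
  note alpha = assms(1) and M = assms(5) and \<tau> = assms(8,9) and A = assms(11)
  fix s :: 'a and k :: 'q
  have haar: "sets \<nu> = sets borel" "\<And>K. compact K \<Longrightarrow> emeasure \<nu> K < \<infinity>"
    using assms(3) by (auto simp: haar_measure_def)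
  have sp: "space \<tau> = UNIV" using sets_eq_imp_space_eq[OF \<tau>(2)] by simp
  have Ma: "Ma B = M (B - A)" if "B \<in> sets borel" for B
    using lebesgue_decomposition_abs_part[OF M haar(1) assms(7) A assms(12) _ that] assms(13) by simp
  have psd: "psd_measure \<tau> M" using M by (simp add: psd_measure_def vector_measure_def \<tau>(2))
  have "\<exists>D. has_RN_derivative \<tau> M D"
  proof (rule psd_measure_RN_exists[OF \<tau> M])
    fix B assume "B \<in> sets \<tau>" "emeasure \<tau> B = 0"
    then show "M B = 0" using assms(10) psd by (intro abs_continuousD) (auto simp: psd_measure_def)
  qed
  then have RN\<tau>: "has_RN_derivative \<tau> M (RN_derivative \<tau> M)" by (rule has_RN_derivative_RN_derivative)
  obtain K :: "nat \<Rightarrow> 'a dual_group set" where K: "\<And>n. compact (K n)"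
    and supp: "\<And>B. B \<in> sets borel \<Longrightarrow> B \<inter> (\<Union>n. K n) = {} \<Longrightarrow> M B = 0"
    using regular_psd_measure_sigma_compact[OF M assms(6)] by blast
  have "\<exists>D. has_RN_derivative \<nu> (\<lambda>B. M (B - A)) D"
  proof (rule RN_exists_of_sigma_compact_support[OF psd_measure_diff_set[OF M A] haar(1), of K])
    fix B assume B: "B \<in> sets \<nu>" "emeasure \<nu> B = 0"
    then have "Ma B = 0" using assms(7) by (intro abs_continuousD) (auto simp: lebesgue_decomposition_def)
    then show "M (B - A) = 0" using Ma B(1) by (simp add: haar(1))
  next
    fix B :: "'a dual_group set" assume B: "B \<in> sets borel" "B \<inter> (\<Union>n. K n) = {}"
    then show "M (B - A) = 0" using A by (intro supp) auto
  qed (use K haar(2) in auto)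
  then have "\<exists>D. has_RN_derivative \<nu> Ma D" by (auto simp: has_RN_derivative_def haar(1) Ma)
  then have RN\<nu>: "has_RN_derivative \<nu> Ma (RN_derivative \<nu> Ma)" by (rule has_RN_derivative_RN_derivative)
  interpret L_alpha \<tau> \<alpha> M by unfold_locales (fact alpha psd RN\<tau>)+
  let ?P = "trig_polys (UNIV - S) :: ('a dual_group \<Rightarrow> complex^'q) set"
  define f where "f t \<gamma> = chi s \<gamma> *s axis k 1 - t \<gamma>" for t and \<gamma> :: "'a dual_group"
  have trigL: "trig_polys X \<subseteq> L_functions \<tau> \<alpha> M" for X :: "'a set"
  proof
    fix t :: "'a dual_group \<Rightarrow> complex^'q" assume "t \<in> trig_polys X"
    note * = trig_poly_measurable_bounded[OF this]
    then show "t \<in> L_functions \<tau> \<alpha> M"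
      using bounded_in_L_functions measurable_cong_sets[OF \<tau>(2) refl] by blast
  qed
  have fL: "f t \<in> L_functions \<tau> \<alpha> M" if "t \<in> ?P" for t
    unfolding f_def using that trigL monomial_in_trig_polys by (intro L_functions_diff) blast+
  have indL: "(\<lambda>\<gamma>. indicator B \<gamma> *\<^sub>R h \<gamma>) \<in> L_functions \<tau> \<alpha> M"
    if B: "B \<in> sets borel" and h: "h \<in> L_functions \<tau> \<alpha> M" for B h
  proof -
    have [measurable]: "B \<in> sets \<tau>" "h \<in> borel_measurable \<tau>" using B h by (auto simp: \<tau> L_functions_weight)
    have "integrable \<tau> (\<lambda>x. indicator B x *\<^sub>R norm (weight x *v h x) powr \<alpha>)"
      using h by (intro integrable_mult_indicator) (auto simp: L_functions_weight)
    moreover have "indicator B x *\<^sub>R norm (weight x *v h x) powr \<alpha> = norm (weight x *v (indicator B x *\<^sub>R h x)) powr \<alpha>" for x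
      by (simp add: indicator_def)
    ultimately show ?thesis by (simp add: L_functions_weight)
  qed
  \<comment> \<open>The quantities minimized on the right-hand side are the norms in \<open>L\<^sup>\<alpha>(M)\<close> of the functions \<open>f t\<close>
      times the indicator of the complement of \<open>A\<close>.\<close>
  define R where "R t = (\<integral>\<gamma>. norm (psd_power (RN_derivative \<nu> Ma \<gamma>) (1 / \<alpha>) *v f t \<gamma>) powr \<alpha> \<partial>\<nu>) powr (1 / \<alpha>)" for t
  have R: "R t = L_norm \<tau> \<alpha> M (\<lambda>\<gamma>. indicator (UNIV - A) \<gamma> *\<^sub>R f t \<gamma>)" if "t \<in> ?P" for t
  proof -
    have "f t \<in> borel_measurable borel"
      using fL[OF that] measurable_cong_sets[OF \<tau>(2) refl] by (auto simp: L_functions_weight)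
    from weighted_integral_abs_part[OF M haar(1) \<tau>(2) RN\<nu> RN\<tau> Ma A this, of \<alpha>] show ?thesis
      using alpha by (simp add: R_def L_norm_def)
  qed
  have le: "R t \<le> L_norm \<tau> \<alpha> M (f t)" if t: "t \<in> ?P" for t
  proof -
    have "(\<integral>x. norm (weight x *v (indicator (UNIV - A) x *\<^sub>R f t x)) powr \<alpha> \<partial>\<tau>) \<le> (\<integral>x. norm (weight x *v f t x) powr \<alpha> \<partial>\<tau>)"
      using indL[of "UNIV - A", OF _ fL[OF t]] fL[OF t] A
      by (intro integral_mono) (auto simp: L_functions_weight indicator_def)
    then show ?thesis unfolding R[OF t] L_norm_weight using alpha by (intro powr_mono2) auto
  qed
  have approx: "\<exists>t'\<in>?P. L_norm \<tau> \<alpha> M (f t') \<le> R t + e" if t: "t \<in> ?P" and e: "0 < e" for t e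
  proof -
    \<comment> \<open>The part of \<open>f t\<close> on \<open>A\<close> lies in the space of the singular part. Subtracting a trigonometric
      polynomial \<open>p\<close> close to it leaves essentially the part of \<open>f t\<close> outside \<open>A\<close>.\<close>
    let ?g = "\<lambda>\<gamma>. indicator A \<gamma> *\<^sub>R f t \<gamma>"
    have gL: "?g \<in> L_functions \<tau> \<alpha> M" by (rule indL[OF A fL[OF t]])
    have "L_class \<tau> M ?g \<in> L_singular_space \<tau> \<alpha> M A"
      unfolding L_singular_space_def using fL[OF t] by blast
    then have "L_class \<tau> M ?g \<in> L_closure \<tau> \<alpha> M (L_class \<tau> M ` ?P)" using assms(14) by blast
    then obtain p where p: "p \<in> ?P" "L_norm \<tau> \<alpha> M (\<lambda>\<gamma>. ?g \<gamma> - p \<gamma>) < e"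
      using L_closure_approx[OF trigL _ _ e] gL by (auto simp: L_functions_weight)
    define h where "h \<gamma> = indicator (UNIV - A) \<gamma> *\<^sub>R f t \<gamma>" for \<gamma>
    have hL: "h \<in> L_functions \<tau> \<alpha> M" unfolding h_def using A by (intro indL fL[OF t]) auto
    have pL: "p \<in> L_functions \<tau> \<alpha> M" using p(1) trigL by blast
    have "f (\<lambda>\<gamma>. t \<gamma> + p \<gamma>) = (\<lambda>\<gamma>. h \<gamma> - (p \<gamma> - ?g \<gamma>))"
      by (auto simp: fun_eq_iff f_def h_def indicator_def)
    then have "L_norm \<tau> \<alpha> M (f (\<lambda>\<gamma>. t \<gamma> + p \<gamma>)) \<le> L_norm \<tau> \<alpha> M h + L_norm \<tau> \<alpha> M (\<lambda>\<gamma>. p \<gamma> - ?g \<gamma>)"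
      using L_norm_diff_le[OF hL L_functions_diff(1)[OF pL gL]] by simp
    moreover have "L_norm \<tau> \<alpha> M (\<lambda>\<gamma>. p \<gamma> - ?g \<gamma>) = L_norm \<tau> \<alpha> M (\<lambda>\<gamma>. ?g \<gamma> - p \<gamma>)"
      by (simp add: L_norm_weight matrix_vector_mult_diff_distrib norm_minus_commute)
    moreover have "L_norm \<tau> \<alpha> M h = R t" unfolding R[OF t] h_def ..
    ultimately have "L_norm \<tau> \<alpha> M (f (\<lambda>\<gamma>. t \<gamma> + p \<gamma>)) \<le> R t + e" using p(2) by simp
    then show ?thesis using trig_polys_add[OF t p(1)] by blast
  qed
  have ne: "?P \<noteq> {}" using zero_in_trig_polys by blast
  have bdd: "bdd_below ((\<lambda>t. L_norm \<tau> \<alpha> M (f t)) ` ?P)" "bdd_below (R ` ?P)"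
    by (auto intro!: bdd_belowI[of _ 0] simp: L_norm_weight R_def)
  have "(INF t\<in>?P. L_norm \<tau> \<alpha> M (f t)) = (INF t\<in>?P. R t)"
  proof (rule antisym)
    show "(INF t\<in>?P. L_norm \<tau> \<alpha> M (f t)) \<le> (INF t\<in>?P. R t)"
    proof (rule cINF_greatest[OF ne], rule field_le_epsilon)
      fix t e assume "t \<in> ?P" "0 < (e::real)"
      from approx[OF this] obtain t' where "t' \<in> ?P" "L_norm \<tau> \<alpha> M (f t') \<le> R t + e" by blast
      then show "(INF t\<in>?P. L_norm \<tau> \<alpha> M (f t)) \<le> R t + e" by (rule cINF_lower2[OF bdd(1)])
    qed
    show "(INF t\<in>?P. R t) \<le> (INF t\<in>?P. L_norm \<tau> \<alpha> M (f t))"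
      by (rule cINF_mono[OF ne bdd(2)]) (use le in blast)
  qed
  then show "(INF t\<in>?P. L_norm \<tau> \<alpha> M (\<lambda>\<gamma>. chi s \<gamma> *s axis k 1 - t \<gamma>)) =
    (INF t\<in>?P. (\<integral>\<gamma>. norm (psd_power (RN_derivative \<nu> Ma \<gamma>) (1 / \<alpha>) *v
                    (chi s \<gamma> *s axis k 1 - t \<gamma>)) powr \<alpha> \<partial>\<nu>) powr (1 / \<alpha>))"
    unfolding R_def f_def .
qed

end
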